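(* Let $\mathbf{k}$ be an algebraically closed field of characteristic $\neq 2,3$, let $n$ be a positive integer, and let $f\in P_3(\mathbf{k}^n)$ have q-rank $r>\exp(240)$. Let $d$ be a positive integer with $d\le \tfrac13\log(r)$. Then the orbit closure of $f$ surjects onto $P_3(\mathbf{k}^d)$.
   Context: $P_e(\mathbf{k}^n)$ is the space of homogeneous degree $e$ polynomials in $n$ variables over $\mathbf{k}$, with its Zariski topology. The q-rank of $f\in P_3(\mathbf{k}^n)$ is the minimal non-negative integer $r$ for which there is an expression $f=\sum_{i=1}^r \ell_i q_i$ with $\ell_i\in P_1(\mathbf{k}^n)$ and $q_i\in P_2(\mathbf{k}^n)$. The orbit closure of $f$ is the Zariski closure in $P_3(\mathbf{k}^n)$ of the $\mathrm{GL}_n(\mathbf{k})$-orbit of $f$. "Surjects onto $P_3(\mathbf{k}^d)$" means that the restriction map $P_3(\mathbf{k}^n)\to P_3(\mathbf{k}^d)$ (induced by the inclusion $\mathbf{k}^d\subset\mathbf{k}^n$; note $d\le r\le n$) maps the orbit closure onto $P_3(\mathbf{k}^d)$. $\log$ is the natural logarithm. *)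

theory Defs
  imports
    "HOL-Library.Poly_Mapping"
    "HOL-Computational_Algebra.Polynomial"
    "HOL-Analysis.Abstract_Topology"
    "Jordan_Normal_Form.Matrix"
begin

section \<open>Multivariate polynomials\<close>

text \<open>
  A monomial in variables indexed by \<open>'i\<close> is its finitely supported exponent function, and
  the polynomial ring is the monoid algebra of the monomials, with the ring operations of
  \<^theory>\<open>HOL-Library.Poly_Mapping\<close>.
\<close>

type_synonym 'i monomial = "'i \<Rightarrow>\<^sub>0 nat"
type_synonym ('i, 'a) mpoly = "'i monomial \<Rightarrow>\<^sub>0 'a"

definition mono_deg :: "'i monomial \<Rightarrow> nat" where
  "mono_deg m = (\<Sum>i\<in>Poly_Mapping.keys m. Poly_Mapping.lookup m i)"

definition Const :: "'a::zero \<Rightarrow> ('i, 'a) mpoly" where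
  "Const c = Poly_Mapping.single 0 c"

definition Var :: "'i \<Rightarrow> ('i, 'a::zero_neq_one) mpoly" where
  "Var i = Poly_Mapping.single (Poly_Mapping.single i 1) 1"

definition mono_eval :: "('i \<Rightarrow> 'b::comm_semiring_1) \<Rightarrow> 'i monomial \<Rightarrow> 'b" where
  "mono_eval x m = (\<Prod>i\<in>Poly_Mapping.keys m. x i ^ Poly_Mapping.lookup m i)"

text \<open>Evaluation at \<open>x\<close> after mapping the coefficients along a ring homomorphism \<open>h\<close>.\<close>

definition mpoly_eval ::
    "('a::zero \<Rightarrow> 'b::comm_semiring_1) \<Rightarrow> ('i \<Rightarrow> 'b) \<Rightarrow> ('i, 'a) mpoly \<Rightarrow> 'b" where
  "mpoly_eval h x p = (\<Sum>m\<in>Poly_Mapping.keys p. h (Poly_Mapping.lookup p m) * mono_eval x m)"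

text \<open>The substitution \<open>f(\<sigma>\<^sub>0, \<sigma>\<^sub>1, \<dots>)\<close>.\<close>

definition mpoly_subst ::
    "('i \<Rightarrow> ('j, 'a::comm_semiring_1) mpoly) \<Rightarrow> ('i, 'a) mpoly \<Rightarrow> ('j, 'a) mpoly" where
  "mpoly_subst \<sigma> f = mpoly_eval Const \<sigma> f"

lemma mono_eval_superset:
  assumes "finite A" "Poly_Mapping.keys m \<subseteq> A"
  shows "mono_eval x m = (\<Prod>i\<in>A. x i ^ Poly_Mapping.lookup m i)"
  unfolding mono_eval_def
  by (rule prod.mono_neutral_left) (use assms in \<open>auto simp: in_keys_iff\<close>)

lemma mono_eval_add: "mono_eval x (m + m') = mono_eval x m * mono_eval x m'"
proof -
  let ?A = "Poly_Mapping.keys m \<union> Poly_Mapping.keys m'"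
  have "Poly_Mapping.keys (m + m') \<subseteq> ?A" by (rule keys_add)
  then show ?thesis
    by (simp add: mono_eval_superset[of ?A] lookup_add power_add prod.distrib)
qed

lemma mpoly_eval_superset:
  assumes "finite A" "Poly_Mapping.keys p \<subseteq> A" "h 0 = 0"
  shows "mpoly_eval h x p = (\<Sum>m\<in>A. h (Poly_Mapping.lookup p m) * mono_eval x m)"
  unfolding mpoly_eval_def
  by (rule sum.mono_neutral_left) (use assms in \<open>auto simp: in_keys_iff\<close>)

lemma mpoly_eval_add:
  assumes "h 0 = 0" "\<And>a b. h (a + b) = h a + h b"
  shows "mpoly_eval h x (p + q) = mpoly_eval h x p + mpoly_eval h x q"
proof -
  let ?A = "Poly_Mapping.keys p \<union> Poly_Mapping.keys q"
  have "Poly_Mapping.keys (p + q) \<subseteq> ?A" by (rule keys_add)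
  then show ?thesis
    by (simp add: mpoly_eval_superset[of ?A] assms lookup_add distrib_right sum.distrib)
qed

lemma mpoly_eval_sum:
  assumes "h 0 = 0" "\<And>a b. h (a + b) = h a + h b"
  shows "mpoly_eval h x (\<Sum>i\<in>I. p i) = (\<Sum>i\<in>I. mpoly_eval h x (p i))"
proof (induction I rule: infinite_finite_induct)
  case (insert i I)
  then show ?case by (simp add: mpoly_eval_add[of h, OF assms])
qed (simp_all add: mpoly_eval_def)

lemma mpoly_eval_single:
  assumes "h 0 = 0"
  shows "mpoly_eval h x (Poly_Mapping.single m c) = h c * mono_eval x m"
  by (subst mpoly_eval_superset[of "{m}"]) (auto simp: assms)

lemma mpoly_sum_single: "p = (\<Sum>m\<in>Poly_Mapping.keys p. Poly_Mapping.single m (Poly_Mapping.lookup p m))"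
  by (rule poly_mapping_eqI)
     (auto simp: lookup_sum lookup_single when_def in_keys_iff sum.delta)

lemma mpoly_eval_mult:
  fixes p q :: "('i, 'a::comm_semiring_1) mpoly"
  assumes h: "h 0 = 0" "\<And>a b. h (a + b) = h a + h b" "\<And>a b. h (a * b) = h a * h b"
  shows "mpoly_eval h x (p * q) = mpoly_eval h x p * mpoly_eval h x q"
proof -
  have "p * q = (\<Sum>m\<in>Poly_Mapping.keys p. Poly_Mapping.single m (Poly_Mapping.lookup p m)) *
      (\<Sum>m'\<in>Poly_Mapping.keys q. Poly_Mapping.single m' (Poly_Mapping.lookup q m'))"
    using mpoly_sum_single[of p] mpoly_sum_single[of q] by metis
  then have "p * q = (\<Sum>m\<in>Poly_Mapping.keys p. \<Sum>m'\<in>Poly_Mapping.keys q.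
      Poly_Mapping.single (m + m') (Poly_Mapping.lookup p m * Poly_Mapping.lookup q m'))"
    by (simp only: sum_product mult_single)
  then show ?thesis
    by (simp only: mpoly_eval_sum[of h, OF h(1,2)] mpoly_eval_single[of h, OF h(1)] h(3)
        mono_eval_add mpoly_eval_def[of h x p] mpoly_eval_def[of h x q] sum_product mult_ac)
qed


section \<open>Homogeneous polynomials and their Zariski topology\<close>

text \<open>\<open>P\<^sub>e(k\<^sup>n)\<close>, in the variables \<open>x\<^sub>0, \<dots>, x\<^sub>n\<^sub>-\<^sub>1\<close>.\<close>

definition homog :: "nat \<Rightarrow> nat \<Rightarrow> (nat, 'a::zero) mpoly set" where
  "homog e n = {f. \<forall>m\<in>Poly_Mapping.keys f. Poly_Mapping.keys m \<subseteq> {..<n} \<and> mono_deg m = e}"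

text \<open>
  The coordinates on \<open>P\<^sub>e(k\<^sup>n)\<close> are the coefficients, so a polynomial function on it is given by
  a polynomial in variables indexed by monomials, evaluated at the coefficient function.
  Monomials outside \<open>P\<^sub>e(k\<^sup>n)\<close> are harmless: their coefficients vanish.
\<close>

definition zero_locus ::
    "nat \<Rightarrow> nat \<Rightarrow> (nat monomial, 'a::comm_semiring_1) mpoly set \<Rightarrow> (nat, 'a) mpoly set" where
  "zero_locus e n \<Phi> = {f \<in> homog e n. \<forall>\<phi>\<in>\<Phi>. mpoly_eval id (Poly_Mapping.lookup f) \<phi> = 0}"

definition zariski :: "nat \<Rightarrow> nat \<Rightarrow> (nat, 'a::idom) mpoly topology" where
  "zariski e n = topology (\<lambda>U. \<exists>\<Phi>. U = homog e n - zero_locus e n \<Phi>)"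

lemma zero_locus_Un:
  fixes \<Phi> \<Psi> :: "(nat monomial, 'a::idom) mpoly set"
  shows "zero_locus e n \<Phi> \<union> zero_locus e n \<Psi> =
    zero_locus e n {\<phi> * \<psi> |\<phi> \<psi>. \<phi> \<in> \<Phi> \<and> \<psi> \<in> \<Psi>}"
proof -
  have "mpoly_eval id x (\<phi> * \<psi>) = mpoly_eval id x \<phi> * mpoly_eval id x \<psi>"
    for x and \<phi> \<psi> :: "(nat monomial, 'a) mpoly"
    by (rule mpoly_eval_mult) auto
  then have "(\<forall>\<chi>\<in>{\<phi> * \<psi> |\<phi> \<psi>. \<phi> \<in> \<Phi> \<and> \<psi> \<in> \<Psi>}. mpoly_eval id x \<chi> = 0) \<longleftrightarrow>
      (\<forall>\<phi>\<in>\<Phi>. \<forall>\<psi>\<in>\<Psi>. mpoly_eval id x \<phi> = 0 \<or> mpoly_eval id x \<psi> = 0)" for x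
    by fastforce
  then show ?thesis
    unfolding zero_locus_def by blast
qed

lemma zero_locus_INT:
  assumes "I \<noteq> {}"
  shows "(\<Inter>i\<in>I. zero_locus e n (\<Phi> i)) = zero_locus e n (\<Union>i\<in>I. \<Phi> i)"
  using assms by (auto simp: zero_locus_def)

lemma zero_locus_one: "zero_locus e n {1} = {}"
proof -
  have "mpoly_eval id x (1 :: (nat monomial, 'a) mpoly) = 1" for x :: "nat monomial \<Rightarrow> 'a"
    by (simp add: mpoly_eval_def mono_eval_def)
  then show ?thesis by (simp add: zero_locus_def)
qed

lemma istopology_zariski:
  "istopology (\<lambda>U :: (nat, 'a::idom) mpoly set. \<exists>\<Phi>. U = homog e n - zero_locus e n \<Phi>)"
  unfolding istopology_def
proof (intro conjI allI impI)
  fix S T :: "(nat, 'a) mpoly set"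
  assume "\<exists>\<Phi>. S = homog e n - zero_locus e n \<Phi>" "\<exists>\<Phi>. T = homog e n - zero_locus e n \<Phi>"
  then obtain \<Phi> \<Psi> where "S = homog e n - zero_locus e n \<Phi>" "T = homog e n - zero_locus e n \<Psi>"
    by blast
  then have "S \<inter> T = homog e n - (zero_locus e n \<Phi> \<union> zero_locus e n \<Psi>)"
    by blast
  then show "\<exists>\<Phi>. S \<inter> T = homog e n - zero_locus e n \<Phi>"
    unfolding zero_locus_Un by blast
next
  fix \<K> :: "(nat, 'a) mpoly set set"
  assume "\<forall>K\<in>\<K>. \<exists>\<Phi>. K = homog e n - zero_locus e n \<Phi>"
  then obtain \<Phi> where \<Phi>: "\<forall>K\<in>\<K>. K = homog e n - zero_locus e n (\<Phi> K)"
    unfolding bchoice_iff by blast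
  show "\<exists>\<Phi>. \<Union>\<K> = homog e n - zero_locus e n \<Phi>"
  proof (cases "\<K> = {}")
    case True
    then show ?thesis by (intro exI[of _ "{}"]) (simp add: zero_locus_def)
  next
    case False
    have "\<Union>\<K> = homog e n - (\<Inter>K\<in>\<K>. zero_locus e n (\<Phi> K))"
      using \<Phi> by blast
    then show ?thesis unfolding zero_locus_INT[OF False] by blast
  qed
qed

lemma openin_zariski: "openin (zariski e n) U \<longleftrightarrow> (\<exists>\<Phi>. U = homog e n - zero_locus e n \<Phi>)"
  unfolding zariski_def topology_inverse'[OF istopology_zariski] ..

lemma topspace_zariski [simp]: "topspace (zariski e n) = homog e n"
proof
  show "topspace (zariski e n) \<subseteq> homog e n"
    by (auto simp: topspace_def openin_zariski)
  have "openin (zariski e n) (homog e n)"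
    unfolding openin_zariski by (rule exI[of _ "{1}"]) (simp add: zero_locus_one)
  then show "homog e n \<subseteq> topspace (zariski e n)" by (rule openin_subset)
qed

lemma closedin_zariski: "closedin (zariski e n) C \<longleftrightarrow> (\<exists>\<Phi>. C = zero_locus e n \<Phi>)"
proof -
  have "zero_locus e n \<Phi> \<subseteq> homog e n" for \<Phi> :: "(nat monomial, 'a) mpoly set"
    by (auto simp: zero_locus_def)
  then show ?thesis
    by (auto simp: closedin_def openin_zariski) (metis Diff_Diff_Int inf.absorb2)
qed


section \<open>q-rank, orbit closure and restriction\<close>

definition q_rank :: "nat \<Rightarrow> (nat, 'a::comm_semiring_1) mpoly \<Rightarrow> nat" where
  "q_rank n f = (LEAST r. \<exists>l q. (\<forall>i<r. l i \<in> homog 1 n \<and> q i \<in> homog 2 n) \<and>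
                                f = (\<Sum>i<r. l i * q i))"

text \<open>The cubic \<open>x \<mapsto> f(g x)\<close>.\<close>

definition mat_subst ::
    "nat \<Rightarrow> 'a::comm_semiring_1 mat \<Rightarrow> (nat, 'a) mpoly \<Rightarrow> (nat, 'a) mpoly" where
  "mat_subst n g f = mpoly_subst (\<lambda>i. \<Sum>j<n. Const (g $$ (i, j)) * Var j) f"

text \<open>
  The left action of \<open>g\<close> sends \<open>f\<close> to \<open>x \<mapsto> f(g\<^sup>-\<^sup>1 x)\<close>; as \<open>g\<close> ranges over the whole group,
  the inverse does not affect the orbit.
\<close>

definition GL_orbit :: "nat \<Rightarrow> (nat, 'a::comm_semiring_1) mpoly \<Rightarrow> (nat, 'a) mpoly set" where
  "GL_orbit n f = {mat_subst n g f |g. g \<in> carrier_mat n n \<and> invertible_mat g}"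

definition orbit_closure :: "nat \<Rightarrow> (nat, 'a::idom) mpoly \<Rightarrow> (nat, 'a) mpoly set" where
  "orbit_closure n f = Abstract_Topology.closure_of (zariski 3 n) (GL_orbit n f)"

text \<open>
  Pullback along the inclusion of \<open>k\<^sup>d\<close> in \<open>k\<^sup>n\<close> as the span of the first \<open>d\<close> basis vectors.
\<close>

definition restrict_vars ::
    "nat \<Rightarrow> (nat, 'a::comm_semiring_1) mpoly \<Rightarrow> (nat, 'a) mpoly" where
  "restrict_vars d f = mpoly_subst (\<lambda>i. if i < d then Var i else 0) f"

end

theory Submission
  imports Defs "Jordan_Normal_Form.Char_Poly" "HOL-Number_Theory.Cong"
begin

text \<open>
  Let \<open>T\<close> be the symmetric trilinear form with \<open>f(x) = T(x, x, x)\<close>.  The proof goes through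
  the inequality \<open>q_rank n f > 2 d\<^sup>2\<close> and rests on the linear forms \<open>T(v\<^sub>i, v\<^sub>j, _)\<close> with \<open>i \<le> j < d\<close> attached to
  vectors \<open>v\<^sub>0, \<dots>, v\<^sub>d\<^sub>-\<^sub>1\<close>.

  If these forms are independent for some \<open>v\<close>, then the map that sends \<open>w\<^sub>0, \<dots>, w\<^sub>d\<^sub>-\<^sub>1\<close> to the cubic
  \<open>f(\<Sum> x\<^sub>i w\<^sub>i)\<close> in \<open>x\<^sub>0, \<dots>, x\<^sub>d\<^sub>-\<^sub>1\<close> has a surjective derivative at \<open>v\<close>.  Hensel lifting turns this into
  density of the image, in every allowed characteristic: for any cubic \<open>g\<close> the line from
  \<open>f(\<Sum> x\<^sub>i v\<^sub>i)\<close> to \<open>g\<close>, with parameter \<open>t\<close>, is to any order in \<open>t\<close> a substitution instance of \<open>f\<close>, so an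
  equation that vanishes on all substitution instances vanishes on the line
  (\<open>hensel_lift_pullback\<close>, \<open>vanishing_on_orbit_imp_everywhere\<close>).  Substitutions by singular matrices
  are limits of those by invertible ones, so \<open>g\<close>, as a cubic in \<open>n\<close> variables, is in the orbit closure.

  If the forms are dependent for every \<open>v\<close>, consider a \<open>v\<close> where their rank is maximal and a relation
  among them.  Moving \<open>v\<close> along a line, and using to second order that the rank cannot rise, shows
  that \<open>f\<close> vanishes on a subspace of codimension at most \<open>2 d\<^sup>2\<close>
  (\<open>isotropic_subspace_if_partials_dependent\<close>).  A cubic vanishing on a subspace of
  codimension \<open>m\<close> has q-rank at most \<open>m\<close> (\<open>q_rank_cub_le_card\<close>), so this case is excluded.

  Finally \<open>d \<le> 1/3 log r\<close> gives \<open>r \<ge> exp (3 d) > 2 d\<^sup>2\<close>.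
\<close>

section \<open>Linear and trilinear forms in coordinates\<close>

text \<open>
  A vector is a function on the natural numbers of which only the entries below \<open>n\<close> count.
  Dimensions thus remain ordinary numbers, and the same formulas serve over the field, over the
  univariate polynomials and over the multivariate polynomials.
\<close>
definition dot :: "nat \<Rightarrow> (nat \<Rightarrow> 'b::comm_ring_1) \<Rightarrow> (nat \<Rightarrow> 'b) \<Rightarrow> 'b" where
  "dot n a x = (\<Sum>i<n. a i * x i)"

definition contr ::
    "nat \<Rightarrow> (nat \<Rightarrow> nat \<Rightarrow> nat \<Rightarrow> 'b::comm_ring_1) \<Rightarrow> (nat \<Rightarrow> 'b) \<Rightarrow> (nat \<Rightarrow> 'b) \<Rightarrow> nat \<Rightarrow> 'b" where
  "contr n T x y k = (\<Sum>i<n. \<Sum>j<n. T i j k * x i * y j)"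

definition tri ::
    "nat \<Rightarrow> (nat \<Rightarrow> nat \<Rightarrow> nat \<Rightarrow> 'b::comm_ring_1) \<Rightarrow> (nat \<Rightarrow> 'b) \<Rightarrow> (nat \<Rightarrow> 'b) \<Rightarrow> (nat \<Rightarrow> 'b) \<Rightarrow> 'b" where
  "tri n T x y z = (\<Sum>i<n. \<Sum>j<n. \<Sum>k<n. T i j k * x i * y j * z k)"

definition sym3 :: "(nat \<Rightarrow> nat \<Rightarrow> nat \<Rightarrow> 'b) \<Rightarrow> bool" where
  "sym3 T \<longleftrightarrow> (\<forall>i j k. T i j k = T j i k \<and> T i j k = T i k j)"

definition indep :: "nat \<Rightarrow> 'i set \<Rightarrow> ('i \<Rightarrow> nat \<Rightarrow> 'a::comm_ring_1) \<Rightarrow> bool" where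
  "indep n I a \<longleftrightarrow> (\<forall>c. (\<forall>k<n. (\<Sum>i\<in>I. c i * a i k) = 0) \<longrightarrow> (\<forall>i\<in>I. c i = 0))"

definition dual_points ::
    "nat \<Rightarrow> 'i set \<Rightarrow> ('i \<Rightarrow> nat \<Rightarrow> 'a::comm_ring_1) \<Rightarrow> ('i \<Rightarrow> nat \<Rightarrow> 'a) \<Rightarrow> bool" where
  "dual_points n I a p \<longleftrightarrow> (\<forall>i\<in>I. \<forall>j\<in>I. dot n (a i) (p j) = (if i = j then 1 else 0))"

lemma dot_add_right: "dot n a (\<lambda>i. x i + y i) = dot n a x + dot n a y"
  by (simp add: dot_def algebra_simps sum.distrib)

lemma dot_diff_right: "dot n a (\<lambda>i. x i - y i) = dot n a x - dot n a y"
  by (simp add: dot_def algebra_simps sum_subtractf)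

lemma dot_scale_right: "dot n a (\<lambda>i. c * x i) = c * dot n a x"
  by (simp add: dot_def sum_distrib_left mult_ac)

lemma dot_sum_right: "dot n a (\<lambda>i. \<Sum>s\<in>S. u s i) = (\<Sum>s\<in>S. dot n a (u s))"
  unfolding dot_def by (subst sum.swap) (simp add: sum_distrib_left)

lemma dot_commute: "dot n a x = dot n x a"
  by (simp add: dot_def mult.commute)

lemma dot_sum_left: "dot n (\<lambda>k. \<Sum>s\<in>S. c s * u s k) x = (\<Sum>s\<in>S. c s * dot n (u s) x)"
  unfolding dot_def by (simp add: sum_distrib_right sum_distrib_left mult_ac) (rule sum.swap)

lemma dot_unit: "k < n \<Longrightarrow> dot n a (\<lambda>i. if i = k then 1 else 0) = a k"
  by (simp add: dot_def if_distrib cong: if_cong)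

lemma tri_eq_dot: "tri n T x y z = dot n (contr n T x y) z"
proof -
  have "tri n T x y z = (\<Sum>i<n. \<Sum>k<n. \<Sum>j<n. T i j k * x i * y j * z k)"
    unfolding tri_def by (rule sum.cong[OF refl], rule sum.swap)
  also have "\<dots> = (\<Sum>k<n. \<Sum>i<n. \<Sum>j<n. T i j k * x i * y j * z k)"
    by (rule sum.swap)
  finally show ?thesis by (simp add: dot_def contr_def sum_distrib_right)
qed

lemma tri_swap12: "tri n T x y z = tri n (\<lambda>i j k. T j i k) y x z"
  unfolding tri_def by (subst sum.swap) (simp add: mult_ac)

lemma tri_swap23: "tri n T x y z = tri n (\<lambda>i j k. T i k j) x z y"
  unfolding tri_def by (rule sum.cong[OF refl], subst sum.swap) (simp add: mult_ac)

lemma sym3_swap12: "sym3 T \<Longrightarrow> (\<lambda>i j k. T j i k) = T"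
  unfolding sym3_def by (intro ext) fastforce

lemma sym3_swap23: "sym3 T \<Longrightarrow> (\<lambda>i j k. T i k j) = T"
  unfolding sym3_def by (intro ext) fastforce

lemma tri_commute12: "sym3 T \<Longrightarrow> tri n T x y z = tri n T y x z"
  using sym3_swap12[of T] by (subst tri_swap12) simp

lemma tri_commute23: "sym3 T \<Longrightarrow> tri n T x y z = tri n T x z y"
  using sym3_swap23[of T] by (subst tri_swap23) simp

lemma tri_add3: "tri n T x y (\<lambda>i. z i + w i) = tri n T x y z + tri n T x y w"
  by (simp add: tri_eq_dot dot_add_right)

lemma tri_add2: "tri n T x (\<lambda>i. z i + w i) y = tri n T x z y + tri n T x w y"
  by (simp only: tri_swap23[of n T x _ y] tri_add3)

lemma tri_add1: "tri n T (\<lambda>i. z i + w i) x y = tri n T z x y + tri n T w x y"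
  by (simp only: tri_swap12[of n T _ x y] tri_add2)

lemmas tri_add = tri_add1 tri_add2 tri_add3

lemma tri_scale3: "tri n T x y (\<lambda>i. c * z i) = c * tri n T x y z"
  by (simp add: tri_eq_dot dot_scale_right)

lemma tri_scale2: "tri n T x (\<lambda>i. c * z i) y = c * tri n T x z y"
  by (simp only: tri_swap23[of n T x _ y] tri_scale3)

lemma tri_scale1: "tri n T (\<lambda>i. c * z i) x y = c * tri n T z x y"
  by (simp only: tri_swap12[of n T _ x y] tri_scale2)

lemmas tri_scale = tri_scale1 tri_scale2 tri_scale3

lemma tri_sum3: "tri n T x y (\<lambda>i. \<Sum>s\<in>S. z s i) = (\<Sum>s\<in>S. tri n T x y (z s))"
  by (simp add: tri_eq_dot dot_sum_right)

lemma tri_sum2: "tri n T x (\<lambda>i. \<Sum>s\<in>S. z s i) y = (\<Sum>s\<in>S. tri n T x (z s) y)"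
  by (simp only: tri_swap23[of n T x _ y] tri_sum3)

lemma tri_sum1: "tri n T (\<lambda>i. \<Sum>s\<in>S. z s i) x y = (\<Sum>s\<in>S. tri n T (z s) x y)"
  by (simp only: tri_swap12[of n T _ x y] tri_sum2)

lemma tri_zero [simp]: "tri n T (\<lambda>i. 0) y z = 0" "tri n T x (\<lambda>i. 0) z = 0" "tri n T x y (\<lambda>i. 0) = 0"
  by (simp_all add: tri_def)

lemma hom_sum:
  assumes "h 0 = 0" "\<And>a b. h (a + b) = h a + h b"
  shows "h (\<Sum>i\<in>I. f i) = (\<Sum>i\<in>I. h (f i))"
  by (induction I rule: infinite_finite_induct) (simp_all add: assms)

lemma tri_hom:
  assumes "h 0 = 0" "\<And>a b. h (a + b) = h a + h b" "\<And>a b. h (a * b) = h a * h b"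
  shows "h (tri n T x y z) = tri n (\<lambda>i j k. h (T i j k)) (\<lambda>i. h (x i)) (\<lambda>i. h (y i)) (\<lambda>i. h (z i))"
  unfolding tri_def by (simp add: hom_sum[of h, OF assms(1,2)] assms(3))

text \<open>
  The coefficients of \<open>x \<mapsto> T(\<Sum>\<^sub>a x\<^sub>a v\<^sub>a, \<Sum>\<^sub>a x\<^sub>a v\<^sub>a, \<Sum>\<^sub>a x\<^sub>a v\<^sub>a)\<close>: the vectors \<open>v a\<close> are the columns of a
  linear substitution.
\<close>
definition pullback ::
    "nat \<Rightarrow> (nat \<Rightarrow> nat \<Rightarrow> nat \<Rightarrow> 'b::comm_ring_1) \<Rightarrow> (nat \<Rightarrow> nat \<Rightarrow> 'b) \<Rightarrow> nat \<Rightarrow> nat \<Rightarrow> nat \<Rightarrow> 'b" where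
  "pullback n T v a b c = tri n T (v a) (v b) (v c)"

lemma tri_linear_subst:
  "tri n T (\<lambda>i. \<Sum>a<m. x a * v a i) (\<lambda>i. \<Sum>a<m. y a * v a i) (\<lambda>i. \<Sum>a<m. z a * v a i) =
   tri m (pullback n T v) x y z"
  unfolding tri_sum1 tri_scale1 tri_sum2 tri_scale2 tri_sum3 tri_scale3
  by (simp only: tri_def[of m] pullback_def sum_distrib_left mult.commute mult.left_commute)

lemma sym3_pullback: "sym3 T \<Longrightarrow> sym3 (pullback n T v)"
  unfolding sym3_def[of "pullback n T v"] pullback_def
  using tri_commute12 tri_commute23 by metis

text \<open>
  A new form that is not a combination of the old ones, after subtracting the combination with
  the same values at the old points, is nonzero at some unit vector \<open>z\<close>.  Projecting \<open>z\<close> into the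
  common kernel of the old forms gives the new point up to scaling, and the old points are then
  corrected along it.
\<close>
lemma ex_dual_points:
  fixes a :: "'i \<Rightarrow> nat \<Rightarrow> 'a::field"
  assumes "finite I" "indep n I a"
  shows "\<exists>p. dual_points n I a p"
  using assms
proof (induction I rule: finite_induct)
  case empty
  then show ?case by (simp add: dual_points_def)
next
  case (insert s I)
  have "indep n I a"
    unfolding indep_def
  proof (intro allI impI ballI)
    fix c i assume c: "\<forall>k<n. (\<Sum>i\<in>I. c i * a i k) = 0" and i: "i \<in> I"
    define c' where "c' = (\<lambda>i. if i = s then 0 else c i)"
    have "\<forall>k<n. (\<Sum>i\<in>insert s I. c' i * a i k) = 0"
    proof (intro allI impI)
      fix k assume "k < n"
      have "(\<Sum>i\<in>I. c' i * a i k) = (\<Sum>i\<in>I. c i * a i k)"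
        by (rule sum.cong) (use insert.hyps in \<open>auto simp: c'_def\<close>)
      then show "(\<Sum>i\<in>insert s I. c' i * a i k) = 0"
        using c \<open>k < n\<close> insert.hyps by (simp add: c'_def)
    qed
    then have "c' i = 0" using insert.prems i unfolding indep_def by blast
    then show "c i = 0" using i insert.hyps by (auto simp: c'_def split: if_splits)
  qed
  then obtain p where p: "dual_points n I a p" using insert.IH by blast
  define c where "c = (\<lambda>i. if i = s then 1 else - dot n (a s) (p i))"
  have "\<not> (\<forall>k<n. (\<Sum>i\<in>insert s I. c i * a i k) = 0)"
    using insert.prems unfolding indep_def by (auto simp: c_def intro!: exI[of _ c])
  then obtain k where k: "k < n" "(\<Sum>i\<in>insert s I. c i * a i k) \<noteq> 0" by blast
  define z :: "nat \<Rightarrow> 'a" where "z = (\<lambda>i. if i = k then 1 else 0)"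
  define y where "y = (\<lambda>l. z l - (\<Sum>i\<in>I. a i k * p i l))"
  have dz: "dot n u z = u k" for u
    using k(1) by (simp add: z_def dot_unit)
  have y: "dot n u y = u k - (\<Sum>i\<in>I. a i k * dot n u (p i))" for u
    by (simp add: y_def dot_diff_right dot_sum_right dot_scale_right dz)
  have yI: "dot n (a j) y = 0" if "j \<in> I" for j
  proof -
    have "(\<Sum>i\<in>I. a i k * dot n (a j) (p i)) = (\<Sum>i\<in>I. if i = j then a j k else 0)"
      by (rule sum.cong) (use p that in \<open>auto simp: dual_points_def\<close>)
    then show ?thesis using that insert.hyps by (simp add: y)
  qed
  have "(\<Sum>i\<in>I. c i * a i k) = - (\<Sum>i\<in>I. a i k * dot n (a s) (p i))"
    unfolding sum_negf[symmetric] by (rule sum.cong) (use insert.hyps in \<open>auto simp: c_def\<close>)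
  then have ys: "dot n (a s) y \<noteq> 0"
    using k(2) insert.hyps by (simp add: y c_def)
  define y' where "y' = (\<lambda>l. inverse (dot n (a s) y) * y l)"
  define p' where "p' = (\<lambda>i l. if i = s then y' l else p i l - dot n (a s) (p i) * y' l)"
  have y': "dot n u y' = inverse (dot n (a s) y) * dot n u y" for u
    by (simp add: y'_def dot_scale_right)
  have "p' s = y'" by (simp add: p'_def)
  moreover have "dot n u (p' i) = dot n u (p i) - dot n (a s) (p i) * dot n u y'" if "i \<in> I" for i u
  proof -
    have "p' i = (\<lambda>l. p i l - dot n (a s) (p i) * y' l)" using that insert.hyps by (auto simp: p'_def)
    then show ?thesis by (simp add: dot_diff_right dot_scale_right)
  qed
  ultimately have "dual_points n (insert s I) a p'"
    using p insert.hyps ys by (auto simp: dual_points_def y' yI)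
  then show ?case by blast
qed

text \<open>
  This is a projection \<open>x \<mapsto> x - \<Sum>\<^sub>t l\<^sub>t(x) z\<^sub>t\<close> onto the common kernel of \<open>S\<close> whose difference
  from the identity has rank at most \<open>card S\<close>.  A further form either vanishes on the kernel already
  reached, or is equal to 1 at some vector \<open>y\<close> of it and can be killed by a multiple of \<open>y\<close>.
\<close>
lemma linear_complement:
  fixes S :: "(nat \<Rightarrow> 'a::field) set"
  assumes "finite S"
  shows "\<exists>l z. \<forall>x. \<forall>s\<in>S. dot n s (\<lambda>i. x i - (\<Sum>t\<in>S. dot n (l t) x * z t i)) = 0"
  using assms
proof (induction S rule: finite_induct)
  case empty
  then show ?case by simp
next
  case (insert s S)
  then obtain l z where lz: "\<And>x t. t \<in> S \<Longrightarrow> dot n t (\<lambda>i. x i - (\<Sum>t\<in>S. dot n (l t) x * z t i)) = 0"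
    by blast
  define P where "P x = (\<lambda>i. x i - (\<Sum>t\<in>S. dot n (l t) x * z t i))" for x
  define e where "e = (\<lambda>k. s k - (\<Sum>t\<in>S. dot n s (z t) * l t k))"
  have sP: "dot n s (P x) = dot n e x" for x
  proof -
    have "dot n e x = dot n s x - (\<Sum>t\<in>S. dot n s (z t) * dot n (l t) x)"
      unfolding e_def dot_commute[of n _ x]
      by (simp add: dot_diff_right dot_sum_right dot_scale_right)
    then show ?thesis
      by (simp add: P_def dot_diff_right dot_sum_right dot_scale_right) (simp add: mult.commute)
  qed
  show ?case
  proof (cases "\<forall>x. dot n s (P x) = 0")
    case True
    define l' where "l' = (\<lambda>t. if t = s then (\<lambda>k. 0) else l t)"
    have "(\<Sum>t\<in>insert s S. dot n (l' t) x * z t i) = (\<Sum>t\<in>S. dot n (l t) x * z t i)" for x i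
    proof -
      have "(\<Sum>t\<in>S. dot n (l' t) x * z t i) = (\<Sum>t\<in>S. dot n (l t) x * z t i)"
        by (rule sum.cong) (use insert.hyps in \<open>auto simp: l'_def\<close>)
      moreover have "dot n (l' s) x = 0" by (simp add: l'_def dot_def)
      ultimately show ?thesis using insert.hyps by simp
    qed
    then have "\<forall>x. \<forall>u\<in>insert s S. dot n u (\<lambda>i. x i - (\<Sum>t\<in>insert s S. dot n (l' t) x * z t i)) = 0"
      using lz True unfolding P_def by simp
    then show ?thesis by blast
  next
    case False
    then obtain x0 where x0: "dot n s (P x0) \<noteq> 0" by blast
    define y where "y = (\<lambda>i. inverse (dot n s (P x0)) * P x0 i)"
    have sy: "dot n s y = 1" using x0 by (simp add: y_def dot_scale_right)
    have ty: "dot n t y = 0" if "t \<in> S" for t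
      using lz[OF that] by (simp add: y_def dot_scale_right P_def)
    define l' where "l' = (\<lambda>t. if t = s then e else l t)"
    define z' where "z' = (\<lambda>t. if t = s then y else z t)"
    have "(\<lambda>i. x i - (\<Sum>t\<in>insert s S. dot n (l' t) x * z' t i)) = (\<lambda>i. P x i - dot n s (P x) * y i)" for x
    proof
      fix i
      have "(\<Sum>t\<in>S. dot n (l' t) x * z' t i) = (\<Sum>t\<in>S. dot n (l t) x * z t i)"
        by (rule sum.cong) (use insert.hyps in \<open>auto simp: l'_def z'_def\<close>)
      then show "x i - (\<Sum>t\<in>insert s S. dot n (l' t) x * z' t i) = P x i - dot n s (P x) * y i"
        using insert.hyps by (simp add: l'_def z'_def sP) (simp add: P_def)
    qed
    then have "\<forall>x. \<forall>u\<in>insert s S. dot n u (\<lambda>i. x i - (\<Sum>t\<in>insert s S. dot n (l' t) x * z' t i)) = 0"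
      using lz by (auto simp: dot_diff_right dot_scale_right sy ty P_def[symmetric])
    then show ?thesis by blast
  qed
qed

text \<open>
  Over a finite field, \<open>1 + \<Prod>\<^sub>a (X - a)\<close> has no root.
\<close>
lemma infinite_alg_closed: "infinite (UNIV :: 'a::alg_closed_field set)"
proof
  assume fin: "finite (UNIV :: 'a set)"
  define p :: "'a poly" where "p = (\<Prod>a\<in>UNIV. [:- a, 1:])"
  have d: "degree p > 0"
    unfolding p_def using fin by (subst degree_prod_eq_sum_degree) (auto simp: card_gt_0_iff)
  have "poly p x = 0" for x
    unfolding p_def poly_prod using fin by (auto simp: prod_zero_iff)
  moreover have "degree (p + 1) > 0" using d by (simp add: degree_add_eq_left)
  ultimately show False
    using alg_closed_imp_poly_has_root[of "p + 1"] by simp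
qed

lemma three_six_nonzero:
  assumes "CHAR('a::field) \<noteq> 2" "CHAR('a) \<noteq> 3"
  shows "(3::'a) \<noteq> 0" "(6::'a) \<noteq> 0"
proof -
  have "CHAR('a) \<noteq> 1" using of_nat_CHAR[where 'a='a] by auto
  then have "\<not> CHAR('a) dvd 2" "\<not> CHAR('a) dvd 3"
    using assms prime_nat_iff[of 2] prime_nat_iff[of 3] two_is_prime_nat by auto
  then have "of_nat 2 \<noteq> (0::'a)" "of_nat 3 \<noteq> (0::'a)"
    unfolding of_nat_eq_0_iff_char_dvd by auto
  then have 2: "(2::'a) \<noteq> 0" and 3: "(3::'a) \<noteq> 0" by simp_all
  show "(3::'a) \<noteq> 0" by (rule 3)
  have "(6::'a) = 2 * 3" by simp
  then show "(6::'a) \<noteq> 0" using 2 3 by (metis mult_eq_0_iff)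
qed

section \<open>Families of linear forms of maximal rank\<close>

text \<open>
  Independence is an open condition.  Evaluating the forms \<open>e\<^sub>i(t)\<close> and \<open>\<delta>(t)\<close> at the points \<open>p\<^sub>j\<close> and
  \<open>y\<close> gives a square matrix of polynomials in \<open>t\<close>.  At \<open>t = 0\<close> it is lower triangular with nonzero
  diagonal, so its determinant is a nonzero polynomial, which has only finitely many roots.
\<close>
lemma indep_persists:
  fixes e :: "'i \<Rightarrow> nat \<Rightarrow> 'a::alg_closed_field poly" and \<delta> :: "nat \<Rightarrow> 'a poly"
  assumes fin: "finite I"
    and p: "dual_points n I (\<lambda>i k. poly (e i k) 0) p"
    and y: "\<And>i. i \<in> I \<Longrightarrow> dot n (\<lambda>k. poly (e i k) 0) y = 0"
    and \<delta>: "dot n (\<lambda>k. poly (\<delta> k) 0) y \<noteq> 0"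
  shows "\<exists>t. t \<noteq> 0 \<and>
    (\<forall>c c'. (\<forall>k<n. (\<Sum>i\<in>I. c i * poly (e i k) t) + c' * poly (\<delta> k) t = 0) \<longrightarrow>
      (\<forall>i\<in>I. c i = 0) \<and> c' = 0)"
proof -
  define m where "m = card I"
  obtain h where h: "bij_betw h {..<m} I"
    using ex_bij_betw_nat_finite[OF fin] by (auto simp: m_def atLeast0LessThan)
  have hI: "i < m \<Longrightarrow> h i \<in> I" for i using bij_betwE[OF h] by auto
  have hinj: "i < m \<Longrightarrow> j < m \<Longrightarrow> h i = h j \<longleftrightarrow> i = j" for i j
    using h by (auto simp: bij_betw_def inj_on_def)
  (* The index m, one past the enumeration of I, stands for the form delta and the point y. *)
  define row where "row i k = (if i < m then e (h i) k else \<delta> k)" for i k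
  define pt where "pt j = (if j < m then p (h j) else y)" for j
  define E :: "'a poly mat" where
    "E = mat (Suc m) (Suc m) (\<lambda>(i, j). \<Sum>k<n. row i k * [:pt j k:])"
  define E' where "E' t = mat (Suc m) (Suc m) (\<lambda>(i, j). dot n (\<lambda>k. poly (row i k) t) (pt j))" for t
  have E' [simp]: "E \<in> carrier_mat (Suc m) (Suc m)" "E' t \<in> carrier_mat (Suc m) (Suc m)" for t
    by (simp_all add: E_def E'_def)
  have detE: "poly (det E) t = det (E' t)" for t
    by (rule poly_det_cong[of _ "Suc m"]) (simp_all add: E_def E'_def dot_def poly_sum mult.commute)
  have diag: "E' 0 $$ (i, j) = (if i = j then if i < m then 1 else dot n (\<lambda>k. poly (\<delta> k) 0) y else 0)"
    if "i \<le> j" "j \<le> m" for i j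
    using that p y by (auto simp: E'_def row_def pt_def dual_points_def hI hinj)
  have "det (E' 0) = prod_list (diag_mat (E' 0))"
    by (rule det_lower_triangular[of "Suc m"]) (simp_all add: diag)
  also have "\<dots> \<noteq> 0"
    unfolding prod_list_zero_iff diag_mat_def using \<delta> by (auto simp: diag E'_def[THEN arg_cong[of _ _ dim_row]] less_Suc_eq_le)
  finally have "poly (det E) 0 \<noteq> 0" by (simp add: detE)
  then have "det E \<noteq> 0" by auto
  then have "finite {t. poly (det E) t = 0}" by (rule poly_roots_finite)
  then have "infinite (UNIV - ({0} \<union> {t. poly (det E) t = 0}))"
    using infinite_alg_closed by (intro Diff_infinite_finite) auto
  then obtain t where "t \<in> UNIV - ({0} \<union> {t. poly (det E) t = 0})"
    using infinite_imp_nonempty by blast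
  then have t: "t \<noteq> 0" "det (E' t) \<noteq> 0" by (auto simp: detE)
  show ?thesis
  proof (intro exI[of _ t] conjI[OF t(1)] allI impI)
    fix c c'
    assume rel: "\<forall>k<n. (\<Sum>i\<in>I. c i * poly (e i k) t) + c' * poly (\<delta> k) t = 0"
    define u where "u = vec (Suc m) (\<lambda>i. if i < m then c (h i) else c')"
    have rel': "(\<Sum>i<Suc m. poly (row i k) t * u $ i) = 0" if "k < n" for k
    proof -
      have "(\<Sum>i\<in>I. c i * poly (e i k) t) = (\<Sum>i<m. c (h i) * poly (e (h i) k) t)"
        by (rule sum.reindex_bij_betw[OF h, symmetric])
      then show ?thesis using rel[rule_format, OF that] by (simp add: u_def row_def mult.commute)
    qed
    have "transpose_mat (E' t) *\<^sub>v u = 0\<^sub>v (Suc m)"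
    proof (rule eq_vecI)
      fix j assume j: "j < dim_vec (0\<^sub>v (Suc m) :: 'a vec)"
      have "(transpose_mat (E' t) *\<^sub>v u) $ j = (\<Sum>i<Suc m. dot n (\<lambda>k. poly (row i k) t) (pt j) * u $ i)"
        using j by (simp add: E'_def u_def scalar_prod_def atLeast0LessThan)
      also have "\<dots> = (\<Sum>i<Suc m. u $ i * dot n (\<lambda>k. poly (row i k) t) (pt j))"
        by (simp only: mult.commute)
      also have "\<dots> = dot n (\<lambda>k. \<Sum>i<Suc m. u $ i * poly (row i k) t) (pt j)"
        by (simp only: dot_sum_left)
      also have "\<dots> = 0"
        unfolding dot_def by (rule sum.neutral) (use rel' in \<open>simp add: mult.commute del: sum.lessThan_Suc\<close>)
      finally show "(transpose_mat (E' t) *\<^sub>v u) $ j = 0\<^sub>v (Suc m) $ j" using j by simp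
    qed (simp add: E'_def)
    moreover have "det (transpose_mat (E' t)) \<noteq> 0" using t(2) by (simp add: det_transpose[of _ "Suc m"])
    ultimately have u0: "u = 0\<^sub>v (Suc m)"
      using det_0_iff_vec_prod_zero[of "transpose_mat (E' t)" "Suc m"] vec_carrier[of "Suc m"]
      unfolding u_def by (metis E'(2) transpose_carrier_mat)
    have ch: "c (h i) = 0" if "i < m" for i
      using arg_cong[OF u0, of "\<lambda>v. v $ i"] that by (simp add: u_def)
    have "c i = 0" if i: "i \<in> I" for i
    proof -
      from i obtain j where "j < m" "i = h j" using h unfolding bij_betw_def by blast
      then show ?thesis using ch by simp
    qed
    moreover have "c' = 0" using arg_cong[OF u0, of "\<lambda>v. v $ m"] by (simp add: u_def)
    ultimately show "(\<forall>i\<in>I. c i = 0) \<and> c' = 0" by blast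
  qed
qed

text \<open>
  Suppose that the span of the \<open>e\<^sub>i(t)\<close>, for \<open>i\<close> in \<open>insert J I\<close>, never has more than \<open>card I\<close>
  dimensions, and has exactly that many at \<open>t = 0\<close>.  If an element \<open>t\<^sup>m \<delta>(t)\<close> of the span is divided by
  \<open>t\<^sup>m\<close>, the limit at \<open>t = 0\<close> still lies in the span of the \<open>e\<^sub>i(0)\<close>, so it vanishes wherever they do:
  otherwise the \<open>e\<^sub>i(t)\<close> with \<open>i \<in> I\<close> and \<open>\<delta>(t)\<close> would be independent for some \<open>t \<noteq> 0\<close>.
\<close>
lemma limit_of_dependent_families:
  fixes e :: "'i \<Rightarrow> nat \<Rightarrow> 'a::alg_closed_field poly"
  assumes fin: "finite I" and J: "J \<notin> I"
    and dep: "\<And>t. \<not> indep n (insert J I) (\<lambda>i k. poly (e i k) t)"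
    and p: "dual_points n I (\<lambda>i k. poly (e i k) 0) p"
    and C: "C J \<noteq> 0"
    and rel: "\<And>k t. k < n \<Longrightarrow> (\<Sum>i\<in>insert J I. C i * poly (e i k) t) = t ^ m * poly (\<delta> k) t"
    and y: "\<And>i. i \<in> I \<Longrightarrow> dot n (\<lambda>k. poly (e i k) 0) y = 0"
  shows "dot n (\<lambda>k. poly (\<delta> k) 0) y = 0"
proof (rule ccontr)
  assume "dot n (\<lambda>k. poly (\<delta> k) 0) y \<noteq> 0"
  from indep_persists[OF fin p y this] obtain t where t: "t \<noteq> 0"
    and ind: "\<forall>c c'. (\<forall>k<n. (\<Sum>i\<in>I. c i * poly (e i k) t) + c' * poly (\<delta> k) t = 0) \<longrightarrow>
           (\<forall>i\<in>I. c i = 0) \<and> c' = 0" by blast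
  from dep[of t] obtain c where c: "\<And>k. k < n \<Longrightarrow> (\<Sum>i\<in>insert J I. c i * poly (e i k) t) = 0"
    and nz: "\<exists>i\<in>insert J I. c i \<noteq> 0" unfolding indep_def by blast
  define q where "q = c J / C J"
  have "(\<Sum>i\<in>I. (c i - q * C i) * poly (e i k) t) + (q * t ^ m) * poly (\<delta> k) t = 0"
    if k: "k < n" for k
  proof -
    have "(\<Sum>i\<in>I. (c i - q * C i) * poly (e i k) t) + q * (\<Sum>i\<in>insert J I. C i * poly (e i k) t) =
        (\<Sum>i\<in>insert J I. c i * poly (e i k) t)"
      using fin J C by (simp add: q_def left_diff_distrib sum_subtractf sum_distrib_left distrib_left mult.assoc)
    then show ?thesis using rel[OF k, of t] c[OF k] by (simp add: mult.assoc)
  qed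
  then have "(\<forall>i\<in>I. c i - q * C i = 0) \<and> q * t ^ m = 0"
    by (intro ind[rule_format]) simp_all
  then have "\<forall>i\<in>I. c i - q * C i = 0" "q * t ^ m = 0" by auto
  then show False using nz t C by (auto simp: q_def)
qed

definition pairs :: "nat \<Rightarrow> (nat \<times> nat) set" where
  "pairs d = {(i, j). i \<le> j \<and> j < d}"

lemma finite_pairs: "finite (pairs d)" and card_pairs_le: "card (pairs d) \<le> d * d"
proof -
  have sub: "pairs d \<subseteq> {..<d} \<times> {..<d}" by (auto simp: pairs_def)
  show "finite (pairs d)" by (rule finite_subset[OF sub]) simp
  show "card (pairs d) \<le> d * d" using card_mono[OF _ sub] by (simp add: card_cartesian_product)
qed

text \<open>
  A quadratic form with a nonzero coefficient is nonzero at some \<open>e\<^sub>i\<close> or \<open>e\<^sub>i + e\<^sub>j\<close>.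
\<close>
lemma quadratic_form_nonvanishing:
  fixes C :: "nat \<times> nat \<Rightarrow> 'a::field"
  assumes J: "J \<in> pairs d" "C J \<noteq> 0"
  obtains a where "(\<Sum>s\<in>pairs d. C s * (a (fst s) * a (snd s))) \<noteq> 0"
proof (rule ccontr)
  assume "\<not> thesis"
  then have z: "(\<Sum>s\<in>pairs d. C s * (a (fst s) * a (snd s))) = 0" for a using that by blast
  note fin = finite_pairs[of d]
  have diag: "C (i, i) = 0" if "i < d" for i
  proof -
    have "(\<Sum>s\<in>pairs d. C s * ((if fst s = i then 1 else 0) * (if snd s = i then 1 else 0))) =
        (\<Sum>s\<in>pairs d. if s = (i, i) then C (i, i) else 0)"
      by (rule sum.cong) auto
    also have "\<dots> = C (i, i)" using fin that by (simp add: pairs_def)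
    finally show ?thesis using z[of "\<lambda>k. if k = i then 1 else 0"] by simp
  qed
  obtain i j where ij: "J = (i, j)" "i < j" "j < d"
    using J diag by (cases J) (fastforce simp: pairs_def le_less)
  define a where "a k = (if k = i \<or> k = j then 1 else 0 :: 'a)" for k
  have "(\<Sum>s\<in>pairs d. C s * (a (fst s) * a (snd s))) = (\<Sum>s\<in>pairs d. if s = (i, j) then C (i, j) else 0)"
  proof (rule sum.cong[OF refl])
    fix s assume "s \<in> pairs d"
    then show "C s * (a (fst s) * a (snd s)) = (if s = (i, j) then C (i, j) else 0)"
      using ij diag by (cases s) (auto simp: a_def pairs_def)
  qed
  also have "\<dots> = C (i, j)" using fin ij by (simp add: pairs_def)
  finally show False using z[of a] J(2) ij by simp
qed

text \<open>
  The linear forms \<open>T(v\<^sub>i, v\<^sub>j, _)\<close>: up to the factor 3, the polarized gradient of the cubic.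
\<close>
definition partials ::
    "nat \<Rightarrow> (nat \<Rightarrow> nat \<Rightarrow> nat \<Rightarrow> 'b::comm_ring_1) \<Rightarrow> (nat \<Rightarrow> nat \<Rightarrow> 'b) \<Rightarrow> nat \<times> nat \<Rightarrow> nat \<Rightarrow> 'b" where
  "partials n T v s = contr n T (v (fst s)) (v (snd s))"

lemma contr_add1: "contr n T (\<lambda>i. x i + y i) z k = contr n T x z k + contr n T y z k"
  by (simp add: contr_def algebra_simps sum.distrib)

lemma contr_add2: "contr n T z (\<lambda>i. x i + y i) k = contr n T z x k + contr n T z y k"
  by (simp add: contr_def algebra_simps sum.distrib)

lemma contr_scale1: "contr n T (\<lambda>i. c * x i) z k = c * contr n T x z k"
  by (simp add: contr_def sum_distrib_left mult_ac)

lemma contr_scale2: "contr n T z (\<lambda>i. c * x i) k = c * contr n T z x k"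
  by (simp add: contr_def sum_distrib_left mult_ac)

lemma contr_sum2: "contr n T z (\<lambda>i. \<Sum>s\<in>S. x s i) k = (\<Sum>s\<in>S. contr n T z (x s) k)"
  by (induction S rule: infinite_finite_induct) (simp_all add: contr_add2, simp_all add: contr_def)

text \<open>
  Write \<open>Q\<^sub>i\<^sub>j(v)\<close> for the linear form \<open>T(v\<^sub>i, v\<^sub>j, _)\<close>.  Choose \<open>v\<close> and a set \<open>I\<close> of pairs with
  independent \<open>Q\<^sub>I(v)\<close> such that \<open>I\<close> is as large as possible.  If \<open>I\<close> misses a pair \<open>J\<close>, there is a relation
  \<open>\<Sum> C\<^sub>i\<^sub>j Q\<^sub>i\<^sub>j(v) = 0\<close> with \<open>C\<^sub>J \<noteq> 0\<close>, and the rank of the forms \<open>Q\<^sub>i\<^sub>j\<close> cannot rise along any path through \<open>v\<close>.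
  Along the path \<open>v\<^sub>i + t a\<^sub>i w\<close> one has

    \<open>\<Sum> C\<^sub>i\<^sub>j Q\<^sub>i\<^sub>j(v + t a w) = t \<beta> + t\<^sup>2 \<gamma>\<close>, where \<open>\<gamma> = (\<Sum> C\<^sub>i\<^sub>j a\<^sub>i a\<^sub>j) T(w, w, _)\<close>,

  and \<open>\<beta>\<close> is linear in \<open>w\<close>.  By the preceding limit principle \<open>\<beta>\<close> lies in the span of \<open>Q\<^sub>I(v)\<close>, so the
  \<open>card I\<close> linear conditions \<open>\<beta>(p\<^sub>i) = 0\<close> on \<open>w\<close>, at points \<open>p\<^sub>i\<close> dual to \<open>Q\<^sub>I(v)\<close>, force \<open>\<beta> = 0\<close>.  Then the
  same principle puts \<open>\<gamma>\<close> into that span.  If moreover \<open>w\<close> is in the common kernel of \<open>Q\<^sub>I(v)\<close>, which is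
  another \<open>card I\<close> conditions, then \<open>\<gamma>(w) = 0\<close>.  Choosing \<open>a\<close> with \<open>\<Sum> C\<^sub>i\<^sub>j a\<^sub>i a\<^sub>j \<noteq> 0\<close> gives
  \<open>T(w, w, w) = 0\<close>.
\<close>
theorem isotropic_subspace_if_partials_dependent:
  fixes T :: "nat \<Rightarrow> nat \<Rightarrow> nat \<Rightarrow> 'a::alg_closed_field"
  assumes T: "sym3 T"
    and none: "\<And>v. \<not> indep n (pairs d) (partials n T v)"
  obtains S where "finite S" "card S \<le> 2 * (d * d)"
    and "\<And>w. (\<And>s. s \<in> S \<Longrightarrow> dot n s w = 0) \<Longrightarrow> tri n T w w w = 0"
proof -
  define good where "good r \<longleftrightarrow> (\<exists>v I. I \<subseteq> pairs d \<and> card I = r \<and> indep n I (partials n T v))" for r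
  have "good 0" unfolding good_def by (intro exI[of _ "{}"] exI) (auto simp: indep_def)
  moreover have bnd: "r \<le> card (pairs d)" if "good r" for r
    using that card_mono[OF finite_pairs] unfolding good_def by blast
  ultimately obtain r where r: "good r" "\<And>r'. good r' \<Longrightarrow> r' \<le> r"
    using GreatestI_nat[of good 0 "card (pairs d)"] Greatest_le_nat[of good _ "card (pairs d)"] by metis
  then obtain v I where I: "I \<subseteq> pairs d" "card I = r" and ind: "indep n I (partials n T v)"
    unfolding good_def by blast
  have finI: "finite I" using I(1) finite_pairs finite_subset by blast
  obtain J where J: "J \<in> pairs d" "J \<notin> I"
    using none ind I(1) by (metis subset_antisym subsetI)
  have dep: "\<not> indep n (insert J I) (partials n T v')" for v'
  proof
    assume "indep n (insert J I) (partials n T v')"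
    then have "good (card (insert J I))" unfolding good_def using I(1) J by blast
    then show False using r(2) I(2) finI J(2) by fastforce
  qed
  obtain p where p: "dual_points n I (partials n T v) p"
    using ex_dual_points[OF finI ind] by blast
  obtain C0 where C0: "\<And>k. k < n \<Longrightarrow> (\<Sum>s\<in>insert J I. C0 s * partials n T v s k) = 0"
    and nz: "\<exists>s\<in>insert J I. C0 s \<noteq> 0"
    using dep[of v] unfolding indep_def by blast
  define C where "C s = (if s \<in> insert J I then C0 s else 0)" for s
  have CJ: "C J \<noteq> 0"
  proof
    assume "C J = 0"
    then have "C0 J = 0" by (simp add: C_def)
    then have "\<forall>s\<in>I. C0 s = 0"
      using C0 ind finI J(2) unfolding indep_def by simp
    then show False using nz \<open>C0 J = 0\<close> by auto
  qed
  have relC: "(\<Sum>s\<in>insert J I. C s * partials n T v s k) = 0" if "k < n" for k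
  proof -
    have "(\<Sum>s\<in>insert J I. C s * partials n T v s k) = (\<Sum>s\<in>insert J I. C0 s * partials n T v s k)"
      by (rule sum.cong[OF refl]) (simp add: C_def)
    then show ?thesis using C0[OF that] by simp
  qed
  obtain a where a': "(\<Sum>s\<in>pairs d. C s * (a (fst s) * a (snd s))) \<noteq> 0"
    using quadratic_form_nonvanishing[of J d C] J(1) CJ by blast
  have a: "(\<Sum>s\<in>insert J I. C s * (a (fst s) * a (snd s))) \<noteq> 0"
  proof -
    have "(\<Sum>s\<in>pairs d. C s * (a (fst s) * a (snd s))) = (\<Sum>s\<in>insert J I. C s * (a (fst s) * a (snd s)))"
      by (rule sum.mono_neutral_right) (use finite_pairs I(1) J(1) in \<open>auto simp: C_def\<close>)
    then show ?thesis using a' by simp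
  qed
  (* T(u, w, _) is the coefficient beta of t along the path described above. *)
  define u where "u = (\<lambda>l. \<Sum>s\<in>insert J I. C s * (a (fst s) * v (snd s) l + a (snd s) * v (fst s) l))"
  define S where "S = partials n T v ` I \<union> (\<lambda>i. contr n T u (p i)) ` I"
  show thesis
  proof (rule that)
    show "finite S" using finI by (simp add: S_def)
    have "card I \<le> d * d" using bnd[OF r(1)] card_pairs_le[of d] I(2) by linarith
    then show "card S \<le> 2 * (d * d)"
      using card_Un_le[of "partials n T v ` I" "(\<lambda>i. contr n T u (p i)) ` I"]
        card_image_le[OF finI, of "partials n T v"] card_image_le[OF finI, of "\<lambda>i. contr n T u (p i)"]
      unfolding S_def by linarith
  next
    fix w assume w: "\<And>s. s \<in> S \<Longrightarrow> dot n s w = 0"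
    have w\<alpha>: "dot n (partials n T v i) w = 0" if "i \<in> I" for i
      using w[of "partials n T v i"] that by (simp add: S_def)
    (* The conditions in S make T(u, w, p i) vanish; symmetry moves w between the slots. *)
    define \<beta> where "\<beta> = contr n T w u"
    have w\<beta>: "dot n \<beta> (p i) = 0" if "i \<in> I" for i
      using w[of "contr n T u (p i)"] that
      by (simp add: S_def \<beta>_def tri_eq_dot[symmetric] tri_commute12[OF T, of n w]
        tri_commute23[OF T, of n _ w])
    define \<gamma> where "\<gamma> k = (\<Sum>s\<in>insert J I. C s * (a (fst s) * a (snd s))) * contr n T w w k" for k
    define e :: "nat \<times> nat \<Rightarrow> nat \<Rightarrow> 'a poly" where
      "e s k = [: partials n T v s k,
          a (fst s) * contr n T w (v (snd s)) k + a (snd s) * contr n T (v (fst s)) w k,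
          a (fst s) * a (snd s) * contr n T w w k :]" for s k
    have e_at: "(\<lambda>s k. poly (e s k) t) = partials n T (\<lambda>i l. v i l + t * (a i * w l))" for t
      by (intro ext, simp add: e_def partials_def contr_add1 contr_add2 contr_scale1 contr_scale2)
         (simp add: algebra_simps)
    have e0: "(\<lambda>s k. poly (e s k) 0) = partials n T v"
      by (intro ext) (simp add: e_def)
    have contr_sym: "contr n T x y k = contr n T y x k" for x y k
      unfolding contr_def using T unfolding sym3_def by (subst sum.swap) (simp add: mult_ac)
    have sum\<beta>: "(\<Sum>s\<in>insert J I. C s * (a (fst s) * contr n T w (v (snd s)) k + a (snd s) * contr n T (v (fst s)) w k)) = \<beta> k" for k
      unfolding \<beta>_def u_def contr_sum2 contr_scale2 contr_add2
      by (rule sum.cong[OF refl]) (simp add: contr_sym[of _ w])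
    have rel: "(\<Sum>s\<in>insert J I. C s * poly (e s k) t) = t * \<beta> k + t ^ 2 * \<gamma> k" if "k < n" for k t
    proof -
      have "(\<Sum>s\<in>insert J I. C s * poly (e s k) t) =
          (\<Sum>s\<in>insert J I. C s * partials n T v s k) +
          t * (\<Sum>s\<in>insert J I. C s * (a (fst s) * contr n T w (v (snd s)) k + a (snd s) * contr n T (v (fst s)) w k))
          + t ^ 2 * ((\<Sum>s\<in>insert J I. C s * (a (fst s) * a (snd s))) * contr n T w w k)"
        unfolding sum_distrib_left sum_distrib_right sum.distrib[symmetric]
        by (rule sum.cong[OF refl]) (simp add: e_def algebra_simps power2_eq_square)
      then show ?thesis using relC[OF that] sum\<beta> by (simp add: \<gamma>_def)
    qed
    have dep': "\<not> indep n (insert J I) (\<lambda>i k. poly (e i k) t)" for t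
      unfolding e_at by (rule dep)
    have \<beta>0: "\<beta> k = 0" if k: "k < n" for k
    proof -
      define z :: "nat \<Rightarrow> 'a" where "z = (\<lambda>i. if i = k then 1 else 0)"
      (* The projection of the unit vector z to the common kernel of the forms in I;
         beta has the same value at y and at z because it vanishes at the points p i. *)
      define y where "y = (\<lambda>l. z l - (\<Sum>i\<in>I. dot n (partials n T v i) z * p i l))"
      have dy: "dot n x y = dot n x z - (\<Sum>i\<in>I. dot n (partials n T v i) z * dot n x (p i))" for x
        by (simp add: y_def dot_diff_right dot_sum_right dot_scale_right)
      have y: "dot n (\<lambda>k. poly (e i k) 0) y = 0" if i: "i \<in> I" for i
      proof -
        have "(\<Sum>j\<in>I. dot n (partials n T v j) z * dot n (partials n T v i) (p j)) =
            (\<Sum>j\<in>I. if j = i then dot n (partials n T v i) z else 0)"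
          by (rule sum.cong) (use p i in \<open>auto simp: dual_points_def\<close>)
        then have "dot n (partials n T v i) y = 0" using finI i by (simp add: dy)
        then show ?thesis using fun_cong[OF e0, of i] by simp
      qed
      have "dot n (\<lambda>k. poly [: \<beta> k, \<gamma> k :] 0) y = 0"
        by (rule limit_of_dependent_families[where e = e and \<delta> = "\<lambda>k. [: \<beta> k, \<gamma> k :]" and m = 1 and C = C,
              OF finI J(2) dep' _ CJ _ y])
          (use p e0 rel in \<open>auto simp: algebra_simps power2_eq_square\<close>)
      then have "dot n \<beta> y = 0" by simp
      then have "dot n \<beta> z = 0" using w\<beta> by (simp add: dy)
      then show ?thesis using k by (simp add: z_def dot_unit)
    qed
    have "dot n (\<lambda>k. poly [: \<gamma> k :] 0) w = 0"
      by (rule limit_of_dependent_families[where e = e and \<delta> = "\<lambda>k. [: \<gamma> k :]" and m = 2 and C = C,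
            OF finI J(2) dep' _ CJ])
        (use p e0 rel \<beta>0 w\<alpha> in \<open>auto simp: fun_cong[OF e0]\<close>)
    then have "(\<Sum>s\<in>insert J I. C s * (a (fst s) * a (snd s))) * tri n T w w w = 0"
      unfolding tri_eq_dot \<gamma>_def by (simp add: dot_def sum_distrib_left mult.assoc del: sum.insert)
    then show "tri n T w w w = 0" using a by simp
  qed
qed

section \<open>Cubic polynomials and their coefficient tensors\<close>

lemma Const_zero [simp]: "Const 0 = 0"
  by (simp add: Const_def)

lemma Const_one: "Const 1 = 1"
  by (simp add: Const_def)

lemma Const_add: "Const (a + b) = Const a + Const b"
  by (simp add: Const_def single_add)

lemma Const_mult: "Const (a * b) = Const a * Const (b::'a::comm_semiring_1)"
  by (simp add: Const_def mult_single)

lemma mono_deg_superset: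
  assumes "finite A" "Poly_Mapping.keys m \<subseteq> A"
  shows "mono_deg m = (\<Sum>i\<in>A. Poly_Mapping.lookup m i)"
  unfolding mono_deg_def by (rule sum.mono_neutral_left) (use assms in \<open>auto simp: in_keys_iff\<close>)

lemma mono_deg_add: "mono_deg (m + m') = mono_deg m + mono_deg m'"
proof -
  let ?A = "Poly_Mapping.keys m \<union> Poly_Mapping.keys m'"
  have "Poly_Mapping.keys (m + m') \<subseteq> ?A" by (rule keys_add)
  then show ?thesis
    by (simp add: mono_deg_superset[of ?A] lookup_add sum.distrib)
qed

lemma homog_0 [simp]: "0 \<in> homog e n"
  by (simp add: homog_def)

lemma homog_Const [simp]: "Const c \<in> homog 0 n"
  by (auto simp: homog_def Const_def mono_deg_def)

lemma homog_Var: "i < n \<Longrightarrow> Var i \<in> homog 1 n"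
  by (auto simp: homog_def Var_def mono_deg_def)

lemma homog_add: "f \<in> homog e n \<Longrightarrow> g \<in> homog e n \<Longrightarrow> f + g \<in> homog e n"
  using keys_add[of f g] unfolding homog_def by blast

lemma homog_sum: "(\<And>i. i \<in> I \<Longrightarrow> f i \<in> homog e n) \<Longrightarrow> (\<Sum>i\<in>I. f i) \<in> homog e n"
  by (induction I rule: infinite_finite_induct) (auto intro: homog_add)

lemma homog_mult:
  assumes "f \<in> homog e n" "g \<in> homog e' n"
  shows "f * g \<in> homog (e + e') n"
proof -
  have "Poly_Mapping.keys m \<subseteq> {..<n} \<and> mono_deg m = e + e'" if "m \<in> Poly_Mapping.keys (f * g)" for m
  proof -
    from that keys_mult[of f g] obtain a b where m: "m = a + b"
      and "a \<in> Poly_Mapping.keys f" "b \<in> Poly_Mapping.keys g" by blast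
    then have "Poly_Mapping.keys a \<subseteq> {..<n}" "mono_deg a = e" "Poly_Mapping.keys b \<subseteq> {..<n}" "mono_deg b = e'"
      using assms by (auto simp: homog_def)
    then show ?thesis using keys_add[of a b] by (auto simp: m mono_deg_add)
  qed
  then show ?thesis by (simp add: homog_def)
qed

lemma homog_tri:
  assumes "\<And>i. i < n \<Longrightarrow> x i \<in> homog a m" "\<And>i. i < n \<Longrightarrow> y i \<in> homog b m"
    "\<And>i. i < n \<Longrightarrow> z i \<in> homog c m"
  shows "tri n (\<lambda>i j k. Const (T i j k)) x y z \<in> homog (a + b + c) m"
  unfolding tri_def
proof (intro homog_sum)
  fix i j k assume "i \<in> {..<n}" "j \<in> {..<n}" "k \<in> {..<n}"
  then have "Const (T i j k) * x i * y j * z k \<in> homog (0 + a + b + c) m"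
    by (intro homog_mult assms homog_Const) auto
  then show "Const (T i j k) * x i * y j * z k \<in> homog (a + b + c) m" by simp
qed

definition cub :: "nat \<Rightarrow> (nat \<Rightarrow> nat \<Rightarrow> nat \<Rightarrow> 'a) \<Rightarrow> (nat, 'a::comm_ring_1) mpoly" where
  "cub n T = tri n (\<lambda>i j k. Const (T i j k)) Var Var Var"

lemma cub_in_homog: "cub n T \<in> homog 3 n"
proof -
  have "cub n T \<in> homog (1 + 1 + 1) n"
    unfolding cub_def by (intro homog_tri homog_Var)
  then show ?thesis by (simp add: numeral_3_eq_3)
qed

lemma cub_add: "cub n (\<lambda>i j k. T i j k + U i j k) = cub n T + cub n U"
  by (simp add: cub_def tri_def Const_add distrib_right sum.distrib)

lemma cub_swap12: "cub n (\<lambda>i j k. T j i k) = cub n T"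
  unfolding cub_def by (subst tri_swap12) simp

lemma cub_swap23: "cub n (\<lambda>i j k. T i k j) = cub n T"
  unfolding cub_def by (subst tri_swap23) simp

lemma cub_unit:
  assumes "i < n" "j < n" "k < n"
  shows "cub n (\<lambda>a b e. if a = i \<and> b = j \<and> e = k then c else 0) = Const c * Var i * Var j * Var k"
proof -
  let ?R = "Const c * Var i * Var j * Var k"
  have "(\<Sum>e<n. Const (if a = i \<and> b = j \<and> e = k then c else 0) * Var a * Var b * Var e) =
      (if a = i \<and> b = j then ?R else 0)" for a b
  proof (cases "a = i \<and> b = j")
    case True
    then have "(\<Sum>e<n. Const (if a = i \<and> b = j \<and> e = k then c else 0) * Var a * Var b * Var e) =
        (\<Sum>e<n. if e = k then ?R else 0)"
      by (intro sum.cong refl) auto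
    then show ?thesis using True assms by simp
  qed auto
  moreover have "(\<Sum>b<n. if a = i \<and> b = j then ?R else 0) = (if a = i then ?R else 0)" for a
    using assms by (cases "a = i") simp_all
  ultimately show ?thesis using assms by (simp add: cub_def tri_def)
qed

text \<open>
  Three applications present a monomial of degree 3 as a product of three variables.
\<close>
lemma monomial_split_variable:
  assumes "mono_deg m = Suc e"
  obtains i m' where "m = Poly_Mapping.single i 1 + m'" "i \<in> Poly_Mapping.keys m"
    "Poly_Mapping.keys m' \<subseteq> Poly_Mapping.keys m" "mono_deg m' = e"
proof -
  from assms have "Poly_Mapping.keys m \<noteq> {}" unfolding mono_deg_def by auto
  then obtain i where i: "i \<in> Poly_Mapping.keys m" by blast
  define m' where "m' = m - Poly_Mapping.single i 1"
  have m: "m = Poly_Mapping.single i 1 + m'"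
    using i by (intro poly_mapping_eqI) (auto simp: m'_def lookup_add lookup_minus lookup_single when_def in_keys_iff)
  have "mono_deg (Poly_Mapping.single i (1::nat)) = 1" by (simp add: mono_deg_def)
  then have "mono_deg m' = e" using assms arg_cong[OF m, of mono_deg] by (simp add: mono_deg_add)
  moreover have "Poly_Mapping.keys m' \<subseteq> Poly_Mapping.keys m"
    by (auto simp: m'_def lookup_minus in_keys_iff)
  ultimately show thesis using that m i by blast
qed

text \<open>
  Each cubic monomial is a product \<open>x\<^sub>i x\<^sub>j x\<^sub>k\<close>, so \<open>f\<close> comes from some tensor, and averaging over the
  six orders of the indices makes that tensor symmetric.  The indices stay below \<open>d\<close> although the
  ambient number of variables is \<open>n\<close>: this is how a cubic in \<open>d\<close> variables is viewed as one in \<open>n\<close>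
  variables.
\<close>
lemma homog_3_eq_cub:
  fixes f :: "(nat, 'a::field) mpoly"
  assumes six: "(6::'a) \<noteq> 0" and f: "f \<in> homog 3 d" and dn: "d \<le> n"
  obtains T where "sym3 T" "\<And>i j k. \<not> (i < d \<and> j < d \<and> k < d) \<Longrightarrow> T i j k = 0" "f = cub n T"
proof -
  define R where "R g \<longleftrightarrow> (\<exists>T. (\<forall>i j k. \<not> (i < d \<and> j < d \<and> k < d) \<longrightarrow> T i j k = 0) \<and> g = cub n T)"
    for g :: "(nat, 'a) mpoly"
  have "R 0" unfolding R_def by (intro exI[of _ "\<lambda>i j k. 0"]) (simp add: cub_def tri_def)
  moreover have "R (g + h)" if "R g" "R h" for g h
  proof -
    from that obtain T U where "\<forall>i j k. \<not> (i < d \<and> j < d \<and> k < d) \<longrightarrow> T i j k = 0" "g = cub n T"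
      "\<forall>i j k. \<not> (i < d \<and> j < d \<and> k < d) \<longrightarrow> U i j k = 0" "h = cub n U"
      unfolding R_def by blast
    then show ?thesis unfolding R_def by (intro exI[of _ "\<lambda>i j k. T i j k + U i j k"]) (simp add: cub_add)
  qed
  moreover have "R (Poly_Mapping.single m (Poly_Mapping.lookup f m))" if m: "m \<in> Poly_Mapping.keys f" for m
  proof -
    let ?c = "Poly_Mapping.lookup f m"
    have md: "Poly_Mapping.keys m \<subseteq> {..<d}" "mono_deg m = Suc (Suc (Suc 0))"
      using f m by (auto simp: homog_def numeral_3_eq_3)
    obtain i m1 where 1: "m = Poly_Mapping.single i 1 + m1" "i \<in> Poly_Mapping.keys m"
      "Poly_Mapping.keys m1 \<subseteq> Poly_Mapping.keys m" "mono_deg m1 = Suc (Suc 0)"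
      using monomial_split_variable[OF md(2)] by metis
    obtain j m2 where 2: "m1 = Poly_Mapping.single j 1 + m2" "j \<in> Poly_Mapping.keys m1"
      "Poly_Mapping.keys m2 \<subseteq> Poly_Mapping.keys m1" "mono_deg m2 = Suc 0"
      using monomial_split_variable[OF 1(4)] by metis
    obtain k m3 where 3: "m2 = Poly_Mapping.single k 1 + m3" "k \<in> Poly_Mapping.keys m2"
      "Poly_Mapping.keys m3 \<subseteq> Poly_Mapping.keys m2" "mono_deg m3 = 0"
      using monomial_split_variable[OF 2(4)] by metis
    have "m3 = 0" using 3(4) unfolding mono_deg_def by (auto simp: in_keys_iff poly_mapping_eq_iff fun_eq_iff)
    have ijk: "i < d" "j < d" "k < d" using 1 2 3 md(1) by blast+
    have "Poly_Mapping.single m ?c = Const ?c * Var i * Var j * Var k"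
      by (simp add: 1(1) 2(1) 3(1) \<open>m3 = 0\<close> Const_def Var_def mult_single add.assoc)
    also have "\<dots> = cub n (\<lambda>a b e. if a = i \<and> b = j \<and> e = k then ?c else 0)"
      using ijk dn by (subst cub_unit) auto
    finally show ?thesis unfolding R_def using ijk
      by (intro exI[of _ "\<lambda>a b e. if a = i \<and> b = j \<and> e = k then ?c else 0"]) auto
  qed
  ultimately have "R (\<Sum>m\<in>A. Poly_Mapping.single m (Poly_Mapping.lookup f m))"
    if "A \<subseteq> Poly_Mapping.keys f" for A
    using that by (induction A rule: infinite_finite_induct) auto
  from this[OF subset_refl] obtain T where supp: "\<And>i j k. \<not> (i < d \<and> j < d \<and> k < d) \<Longrightarrow> T i j k = 0" and fT: "f = cub n T"
    unfolding R_def mpoly_sum_single[of f, symmetric] by blast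
  define U where "U i j k = T i j k / 6" for i j k
  define V where "V i j k = U i j k + U i k j + U j i k + U j k i + U k i j + U k j i" for i j k
  show thesis
  proof (rule that)
    show "sym3 V" by (simp add: sym3_def V_def add_ac)
    show "V i j k = 0" if "\<not> (i < d \<and> j < d \<and> k < d)" for i j k
      using that by (auto simp: V_def U_def supp)
    have "T = (\<lambda>i j k. U i j k + U i j k + U i j k + U i j k + U i j k + U i j k)"
      using six by (intro ext) (simp add: U_def field_simps)
    then have "f = cub n U + cub n U + cub n U + cub n U + cub n U + cub n U"
      unfolding fT by (simp only: cub_add)
    moreover have "cub n (\<lambda>i j k. U i k j) = cub n U" by (rule cub_swap23)
    moreover have "cub n (\<lambda>i j k. U j i k) = cub n U" by (rule cub_swap12)
    moreover have "cub n (\<lambda>i j k. U j k i) = cub n U"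
      by (rule trans[OF cub_swap12[of n "\<lambda>i j k. U i k j"] cub_swap23])
    moreover have kij: "cub n (\<lambda>i j k. U k i j) = cub n U"
      by (rule trans[OF cub_swap23[of n "\<lambda>i j k. U j i k"] cub_swap12])
    moreover have "cub n (\<lambda>i j k. U k j i) = cub n U"
      by (rule trans[OF cub_swap12[of n "\<lambda>i j k. U k i j"] kij])
    ultimately show "f = cub n V"
      unfolding V_def cub_add by (simp only:)
  qed
qed

lemma mpoly_subst_cub: "mpoly_subst \<sigma> (cub n T) = tri n (\<lambda>i j k. Const (T i j k)) \<sigma> \<sigma> \<sigma>"
proof -
  have C: "mpoly_eval Const \<sigma> (Const c) = Const c" for c
    unfolding Const_def[of c] by (subst mpoly_eval_single) (simp_all add: mono_eval_def Const_def)
  have V: "mpoly_eval Const \<sigma> (Var i) = \<sigma> i" for i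
    unfolding Var_def by (subst mpoly_eval_single) (simp_all add: mono_eval_def Const_one)
  show ?thesis
    unfolding mpoly_subst_def cub_def
    by (subst tri_hom[of "mpoly_eval Const \<sigma>"])
       (simp_all add: mpoly_eval_def[of _ _ 0] mpoly_eval_add[of Const, OF Const_zero Const_add]
         mpoly_eval_mult[of Const, OF Const_zero Const_add Const_mult] C V)
qed

lemma tri_cong:
  assumes "\<And>i. i < n \<Longrightarrow> x i = x' i" "\<And>i. i < n \<Longrightarrow> y i = y' i" "\<And>i. i < n \<Longrightarrow> z i = z' i"
  shows "tri n T x y z = tri n T x' y' z'"
  unfolding tri_def by (intro sum.cong refl) (simp add: assms)

lemma tri_Const_linear_subst:
  fixes T :: "nat \<Rightarrow> nat \<Rightarrow> nat \<Rightarrow> 'a::comm_ring_1"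
  shows "tri n (\<lambda>i j k. Const (T i j k)) (\<lambda>i. \<Sum>a<m. Var a * Const (v a i)) (\<lambda>i. \<Sum>a<m. Var a * Const (v a i))
     (\<lambda>i. \<Sum>a<m. Var a * Const (v a i)) = cub m (pullback n T v)"
proof -
  have "pullback n (\<lambda>i j k. Const (T i j k) :: (nat, 'a) mpoly) (\<lambda>a i. Const (v a i)) = (\<lambda>a b c. Const (pullback n T v a b c))"
    unfolding pullback_def
    by (intro ext tri_hom[of Const, OF Const_zero Const_add Const_mult, symmetric])
  then show ?thesis unfolding tri_linear_subst cub_def by simp
qed

lemma mat_subst_cub: "mat_subst n g (cub n T) = cub n (pullback n T (\<lambda>a i. g $$ (i, a)))"
  unfolding mat_subst_def mpoly_subst_cub tri_Const_linear_subst[symmetric]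
  by (simp only: mult.commute)

lemma restrict_vars_in_homog:
  "restrict_vars d (cub n T) \<in> homog 3 d"
proof -
  have "restrict_vars d (cub n T) \<in> homog (1 + 1 + 1) d"
    unfolding restrict_vars_def mpoly_subst_cub by (intro homog_tri) (auto intro: homog_Var[unfolded One_nat_def])
  then show ?thesis by (simp add: numeral_3_eq_3)
qed

lemma restrict_vars_id:
  assumes "\<And>i j k. \<not> (i < d \<and> j < d \<and> k < d) \<Longrightarrow> T i j k = 0"
  shows "restrict_vars d (cub n T) = cub n T"
  unfolding restrict_vars_def mpoly_subst_cub unfolding cub_def tri_def
proof (intro sum.cong refl)
  fix i j k
  show "Const (T i j k) * (if i < d then Var i else 0) * (if j < d then Var j else 0) * (if k < d then Var k else 0) =
      Const (T i j k) * Var i * Var j * Var k"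
    using assms[of i j k] by (cases "i < d \<and> j < d \<and> k < d") auto
qed

section \<open>The q-rank of a cubic that vanishes on a large subspace\<close>

lemma q_rank_le_card:
  fixes l :: "'s \<Rightarrow> (nat, 'a::comm_semiring_1) mpoly"
  assumes "finite S" "\<And>s. s \<in> S \<Longrightarrow> l s \<in> homog 1 n" "\<And>s. s \<in> S \<Longrightarrow> q s \<in> homog 2 n"
    and f: "f = (\<Sum>s\<in>S. l s * q s)"
  shows "q_rank n f \<le> card S"
proof -
  obtain h where h: "bij_betw h {..<card S} S"
    using ex_bij_betw_nat_finite[OF assms(1)] by (auto simp: atLeast0LessThan)
  have "f = (\<Sum>i<card S. (l \<circ> h) i * (q \<circ> h) i)"
    unfolding f by (simp add: sum.reindex_bij_betw[OF h, symmetric])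
  then show ?thesis
    unfolding q_rank_def using assms(2,3) bij_betwE[OF h]
    by (intro Least_le exI[of _ "l \<circ> h"] exI[of _ "q \<circ> h"]) auto
qed

text \<open>
  The vanishing of the cubic at \<open>x + y\<close> gives \<open>3 (T(x,x,y) + T(x,y,y)) = 0\<close>; replacing \<open>y\<close> by \<open>y + z\<close>
  there leaves \<open>2 T(x,y,z) = 0\<close>.
\<close>
lemma polarization:
  fixes T :: "nat \<Rightarrow> nat \<Rightarrow> nat \<Rightarrow> 'a::field"
  assumes six: "(6::'a) \<noteq> 0" and T: "sym3 T"
    and add: "\<And>x y. V x \<Longrightarrow> V y \<Longrightarrow> V (\<lambda>i. x i + y i)"
    and zero: "\<And>x. V x \<Longrightarrow> tri n T x x x = 0"
    and xyz: "V x" "V y" "V z"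
  shows "tri n T x y z = 0"
proof -
  have "(6::'a) = 2 * 3" by simp
  then have 23: "(2::'a) \<noteq> 0" "(3::'a) \<noteq> 0" using six by (metis mult_eq_0_iff)+
  have *: "tri n T x x y + tri n T x y y = 0" if "V x" "V y" for x y
  proof -
    have "tri n T x y x = tri n T x x y" "tri n T y x x = tri n T x x y"
      "tri n T y x y = tri n T x y y" "tri n T y y x = tri n T x y y"
      by (metis T tri_commute12 tri_commute23)+
    then have "3 * (tri n T x x y + tri n T x y y) = 0"
      using zero[OF add[OF that]] zero[OF that(1)] zero[OF that(2)]
      unfolding tri_add by (simp add: algebra_simps)
    then show ?thesis using 23 unfolding mult_eq_0_iff by blast
  qed
  have xzy: "tri n T x z y = tri n T x y z" by (rule tri_commute23[OF T])
  have "tri n T x x (\<lambda>i. y i + z i) + tri n T x (\<lambda>i. y i + z i) (\<lambda>i. y i + z i) =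
      (tri n T x x y + tri n T x y y) + (tri n T x x z + tri n T x z z) + 2 * tri n T x y z"
    unfolding tri_add xzy by (simp add: algebra_simps)
  then have "2 * tri n T x y z = 0"
    unfolding *[OF xyz(1) add[OF xyz(2,3)]] *[OF xyz(1,2)] *[OF xyz(1,3)] by simp
  then show ?thesis using 23 by simp
qed

text \<open>
  Let \<open>X\<close> be the generic point of the common kernel of \<open>S\<close>, obtained by projecting the vector of the
  variables.  The variables are \<open>X + \<Sum>\<^sub>t L\<^sub>t z\<^sub>t\<close> with \<open>card S\<close> linear forms \<open>L\<^sub>t\<close>.  Expanding \<open>T\<close> one slot
  at a time leaves \<open>T(X, X, X)\<close>, which is 0 by polarization, and terms with a factor \<open>L\<^sub>t\<close>.
\<close>
lemma q_rank_cub_le_card: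
  fixes T :: "nat \<Rightarrow> nat \<Rightarrow> nat \<Rightarrow> 'a::field"
  assumes six: "(6::'a) \<noteq> 0" and T: "sym3 T" and S: "finite S"
    and van: "\<And>w. (\<And>s. s \<in> S \<Longrightarrow> dot n s w = 0) \<Longrightarrow> tri n T w w w = 0"
  shows "q_rank n (cub n T) \<le> card S"
proof -
  obtain l z where lz: "\<forall>x. \<forall>s\<in>S. dot n s (\<lambda>i. x i - (\<Sum>t\<in>S. dot n (l t) x * z t i)) = 0"
    using linear_complement[OF S] by blast
  define unit :: "nat \<Rightarrow> nat \<Rightarrow> 'a" where "unit a i = (if i = a then 1 else 0)" for a i
  define v where "v a i = unit a i - (\<Sum>t\<in>S. dot n (l t) (unit a) * z t i)" for a i
  have v_dot: "dot n s (v a) = 0" if "s \<in> S" for s a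
  proof -
    have "v a = (\<lambda>i. unit a i - (\<Sum>t\<in>S. dot n (l t) (unit a) * z t i))"
      by (intro ext) (rule v_def)
    then show ?thesis using lz that by simp
  qed
  have iso: "pullback n T v a b c = 0" for a b c
    unfolding pullback_def
    by (rule polarization[OF six T, where V = "\<lambda>w. \<forall>s\<in>S. dot n s w = 0"])
       (use van v_dot in \<open>auto simp: dot_add_right\<close>)
  define CT :: "nat \<Rightarrow> nat \<Rightarrow> nat \<Rightarrow> (nat, 'a) mpoly" where "CT = (\<lambda>i j k. Const (T i j k))"
  define X :: "nat \<Rightarrow> (nat, 'a) mpoly" where "X i = (\<Sum>a<n. Var a * Const (v a i))" for i
  define L where "L t = (\<Sum>a<n. Const (dot n (l t) (unit a)) * Var a)" for t
  define Z :: "_ \<Rightarrow> nat \<Rightarrow> (nat, 'a) mpoly" where "Z t i = Const (z t i)" for t i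
  have XX: "tri n CT X X X = 0"
    unfolding CT_def X_def tri_Const_linear_subst
    by (simp add: cub_def tri_def iso)
  have Var_eq: "Var i = X i + (\<Sum>t\<in>S. L t * Z t i)" if "i < n" for i
  proof -
    have "(Const (unit a i) :: (nat, 'a) mpoly) =
        Const (v a i) + (\<Sum>t\<in>S. Const (dot n (l t) (unit a)) * Const (z t i))" for a
    proof -
      have "(Const (unit a i) :: (nat, 'a) mpoly) = Const (v a i + (\<Sum>t\<in>S. dot n (l t) (unit a) * z t i))"
        by (simp add: v_def)
      also have "\<dots> = Const (v a i) + (\<Sum>t\<in>S. Const (dot n (l t) (unit a) * z t i))"
        unfolding Const_add by (simp add: hom_sum[of Const, OF Const_zero Const_add])
      finally show ?thesis by (simp add: Const_mult)
    qed
    then have "(\<Sum>a<n. Var a * Const (unit a i)) =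
        X i + (\<Sum>a<n. \<Sum>t\<in>S. Var a * (Const (dot n (l t) (unit a)) * Const (z t i)))"
      by (simp add: X_def distrib_left sum.distrib sum_distrib_left)
    also have "(\<Sum>a<n. \<Sum>t\<in>S. Var a * (Const (dot n (l t) (unit a)) * Const (z t i))) = (\<Sum>t\<in>S. L t * Z t i)"
      unfolding L_def Z_def sum_distrib_right
      by (subst sum.swap) (simp add: mult_ac)
    also have "(\<Sum>a<n. Var a * Const (unit a i)) = (\<Sum>a<n. if a = i then Var a else 0)"
      by (intro sum.cong refl) (simp add: unit_def Const_one)
    also have "\<dots> = Var i" using that by simp
    finally show ?thesis .
  qed
  define W where "W i = (\<Sum>t\<in>S. L t * Z t i)" for i
  have V: "tri n CT Var y u = tri n CT X y u + tri n CT W y u"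
    "tri n CT y Var u = tri n CT y X u + tri n CT y W u"
    "tri n CT y u Var = tri n CT y u X + tri n CT y u W" for y u
    unfolding tri_add[symmetric] by (rule tri_cong; simp add: Var_eq W_def)+
  define q where "q t = tri n CT (Z t) Var Var + tri n CT X (Z t) Var + tri n CT X X (Z t)" for t
  have "cub n T = tri n CT W Var Var + tri n CT X W Var + tri n CT X X W"
    unfolding cub_def CT_def[symmetric]
    by (subst V(1), subst (1) V(2), subst (1) V(3)) (simp add: XX)
  also have "\<dots> = (\<Sum>t\<in>S. L t * q t)"
    unfolding W_def tri_sum1 tri_sum2 tri_sum3 tri_scale1 tri_scale2 tri_scale3 q_def
    by (simp add: distrib_left sum.distrib)
  finally have eq: "cub n T = (\<Sum>t\<in>S. L t * q t)" .
  have hX: "X i \<in> homog 1 n" for i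
    unfolding X_def by (intro homog_sum, subst add_0_right[symmetric], intro homog_mult)
      (auto intro: homog_Var[unfolded One_nat_def])
  have hL: "L t \<in> homog 1 n" for t
    unfolding L_def by (intro homog_sum, subst add_0_left[symmetric], intro homog_mult)
      (auto intro: homog_Var[unfolded One_nat_def])
  have hZ: "Z t i \<in> homog 0 n" for t i by (simp add: Z_def)
  have "q t \<in> homog 2 n" for t
  proof -
    have "tri n CT (Z t) Var Var \<in> homog (0 + 1 + 1) n" "tri n CT X (Z t) Var \<in> homog (1 + 0 + 1) n"
      "tri n CT X X (Z t) \<in> homog (1 + 1 + 0) n"
      unfolding CT_def by (intro homog_tri hX hZ homog_Var; assumption)+
    then show ?thesis unfolding q_def by (intro homog_add) (simp_all add: numeral_2_eq_2)
  qed
  then show ?thesis using q_rank_le_card[OF S hL _ eq] by blast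
qed

lemma q_rank_cub_le_dim:
  fixes T :: "nat \<Rightarrow> nat \<Rightarrow> nat \<Rightarrow> 'a::field"
  assumes "(6::'a) \<noteq> 0" "sym3 T"
  shows "q_rank n (cub n T) \<le> n"
proof -
  let ?S = "(\<lambda>k i. if i = k then 1 else (0::'a)) ` {..<n}"
  have "q_rank n (cub n T) \<le> card ?S"
  proof (rule q_rank_cub_le_card[OF assms])
    fix w assume w: "\<And>s. s \<in> ?S \<Longrightarrow> dot n s w = 0"
    have "w k = 0" if "k < n" for k
      using w[of "\<lambda>i. if i = k then 1 else 0"] that dot_unit[OF that, of w] by (simp add: dot_commute)
    then show "tri n T w w w = 0" by (simp add: tri_def)
  qed simp
  also have "\<dots> \<le> n" using card_image_le[of "{..<n}"] by simp
  finally show ?thesis .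
qed

section \<open>Equations that vanish on the orbit\<close>

definition cub_coeff ::
    "nat \<Rightarrow> (nat \<Rightarrow> nat \<Rightarrow> nat \<Rightarrow> 'b::comm_ring_1) \<Rightarrow> nat monomial \<Rightarrow> 'b" where
  "cub_coeff n T m = (\<Sum>i<n. \<Sum>j<n. \<Sum>k<n.
     if Poly_Mapping.single i 1 + Poly_Mapping.single j 1 + Poly_Mapping.single k 1 = m then T i j k else 0)"

lemma lookup_cub: "Poly_Mapping.lookup (cub n T) = cub_coeff n T"
proof
  fix m
  have "Const (T i j k) * Var i * Var j * Var k =
      Poly_Mapping.single (Poly_Mapping.single i 1 + Poly_Mapping.single j 1 + Poly_Mapping.single k 1) (T i j k)"
    for i j k by (simp add: Const_def Var_def mult_single)
  then show "Poly_Mapping.lookup (cub n T) m = cub_coeff n T m"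
    by (simp add: cub_def tri_def cub_coeff_def lookup_sum lookup_single when_def)
qed

lemma cub_cong:
  assumes "\<And>i j k. i < n \<Longrightarrow> j < n \<Longrightarrow> k < n \<Longrightarrow> T i j k = U i j k"
  shows "cub n T = cub n U"
  unfolding cub_def tri_def by (intro sum.cong refl) (simp add: assms)

text \<open>
  The value of the equation \<open>\<phi>\<close> at a cubic whose coefficients are polynomials in a parameter \<open>t\<close>.
\<close>
definition eval_family ::
    "nat \<Rightarrow> (nat monomial, 'a::comm_ring_1) mpoly \<Rightarrow> (nat \<Rightarrow> nat \<Rightarrow> nat \<Rightarrow> 'a poly) \<Rightarrow> 'a poly" where
  "eval_family n \<phi> T = mpoly_eval (\<lambda>c. [:c:]) (cub_coeff n T) \<phi>"

lemma poly_eval_family: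
  "poly (eval_family n \<phi> T) t =
   mpoly_eval id (Poly_Mapping.lookup (cub n (\<lambda>i j k. poly (T i j k) t))) \<phi>"
proof -
  have "poly (cub_coeff n T m) t = cub_coeff n (\<lambda>i j k. poly (T i j k) t) m" for m
    unfolding cub_coeff_def poly_sum by (intro sum.cong refl) simp
  then show ?thesis
    by (simp add: eval_family_def mpoly_eval_def mono_eval_def poly_sum poly_prod lookup_cub)
qed

lemma eval_family_cong:
  fixes T U :: "nat \<Rightarrow> nat \<Rightarrow> nat \<Rightarrow> 'a::field poly"
  assumes "\<And>i j k. M dvd T i j k - U i j k"
  shows "M dvd eval_family n \<phi> T - eval_family n \<phi> U"
proof -
  have TU: "T i j k mod M = U i j k mod M" for i j k
    using assms by (simp add: mod_eq_dvd_iff)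
  have c: "[cub_coeff n T m = cub_coeff n U m] (mod M)" for m
    unfolding cub_coeff_def by (intro cong_sum) (simp add: cong_def TU)
  have "[eval_family n \<phi> T = eval_family n \<phi> U] (mod M)"
    unfolding eval_family_def mpoly_eval_def mono_eval_def
    by (intro cong_sum cong_mult cong_refl cong_prod cong_pow c)
  then show ?thesis by (simp add: cong_def mod_eq_dvd_iff)
qed

lemma poly_eq_0_if_cofinitely_many_roots:
  fixes p :: "'a::alg_closed_field poly"
  assumes "finite {t. poly p t \<noteq> 0}"
  shows "p = 0"
proof (rule ccontr)
  assume "p \<noteq> 0"
  then have "finite ({t. poly p t = 0} \<union> {t. poly p t \<noteq> 0})"
    using assms poly_roots_finite by blast
  moreover have "{t. poly p t = 0} \<union> {t. poly p t \<noteq> 0} = UNIV" by blast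
  ultimately show False using infinite_alg_closed by metis
qed

lemma invertible_mat_if_det_nonzero:
  fixes g :: "'a::field mat"
  assumes g: "g \<in> carrier_mat n n" and "det g \<noteq> 0"
  shows "invertible_mat g"
proof -
  from det_non_zero_imp_unit[OF assms, of "()"] obtain h
    where "h \<in> carrier_mat n n" "h * g = 1\<^sub>m n" "g * h = 1\<^sub>m n"
    unfolding Units_def ring_mat_def by auto
  then show ?thesis using g unfolding invertible_mat_def inverts_mat_def by auto
qed

text \<open>
  Invertible matrices are dense: \<open>A + s I\<close> is invertible unless \<open>s\<close> is a root of the characteristic
  polynomial of \<open>-A\<close>, and the value of \<open>\<phi>\<close> along this family is a polynomial in \<open>s\<close>.
\<close>
lemma vanishing_on_orbit_imp_on_pullbacks:
  fixes T :: "nat \<Rightarrow> nat \<Rightarrow> nat \<Rightarrow> 'a::alg_closed_field"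
  assumes \<phi>: "\<And>g. g \<in> carrier_mat n n \<Longrightarrow> invertible_mat g \<Longrightarrow>
      mpoly_eval id (Poly_Mapping.lookup (mat_subst n g (cub n T))) \<phi> = 0"
  shows "mpoly_eval id (Poly_Mapping.lookup (cub n (pullback n T A))) \<phi> = 0"
proof -
  define U where "U = pullback n (\<lambda>i j k. [:T i j k:]) (\<lambda>a i. [:A a i, if i = a then 1 else 0:])"
  have U: "poly (U a b c) s = pullback n T (\<lambda>a i. A a i + s * (if i = a then 1 else 0)) a b c" for a b c s
    unfolding U_def pullback_def by (subst tri_hom[of "\<lambda>p. poly p s"]) simp_all
  define B where "B = mat n n (\<lambda>(i, a). - A a i)"
  have B: "B \<in> carrier_mat n n" by (simp add: B_def)
  have "poly (eval_family n \<phi> U) s = 0" if s: "poly (char_poly B) s \<noteq> 0" for s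
  proof -
    let ?g = "- char_matrix B s"
    have g: "?g \<in> carrier_mat n n" using B by simp
    have "?g $$ (i, a) = A a i + s * (if i = a then 1 else 0)" if "i < n" "a < n" for i a
      using that by (simp add: char_matrix_def B_def)
    then have "mat_subst n ?g (cub n T) = cub n (pullback n T (\<lambda>a i. A a i + s * (if i = a then 1 else 0)))"
      unfolding mat_subst_cub pullback_def by (intro cub_cong tri_cong) simp_all
    moreover have "invertible_mat ?g"
      using s by (intro invertible_mat_if_det_nonzero[OF g]) (simp add: char_poly_matrix[OF B])
    ultimately show ?thesis using \<phi>[OF g] by (simp add: poly_eval_family U)
  qed
  then have "{s. poly (eval_family n \<phi> U) s \<noteq> 0} \<subseteq> {s. poly (char_poly B) s = 0}" by blast
  moreover have "char_poly B \<noteq> 0" using degree_monic_char_poly[OF B] by auto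
  ultimately have "eval_family n \<phi> U = 0"
    by (intro poly_eq_0_if_cofinitely_many_roots) (metis poly_roots_finite finite_subset)
  then have "poly (eval_family n \<phi> U) 0 = 0" by simp
  then show ?thesis by (simp add: poly_eval_family U)
qed

section \<open>Hensel lifting along a line of cubics\<close>

text \<open>
  The left-hand side is the derivative of \<open>v \<mapsto> pullback n T v\<close> in the direction \<open>w\<close>.  As the forms
  \<open>T(v\<^sub>a, v\<^sub>b, _)\<close> with \<open>a \<le> b < d\<close> are independent, they take prescribed values at a suitable \<open>w\<^sub>c\<close>, here
  \<open>G a b c / 3\<close>, and by symmetry all three summands are then equal.
\<close>
lemma linearized_pullback_solvable:
  fixes T :: "nat \<Rightarrow> nat \<Rightarrow> nat \<Rightarrow> 'a::field"
  assumes three: "(3::'a) \<noteq> 0" and T: "sym3 T"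
    and v: "\<And>a. d \<le> a \<Longrightarrow> v a = (\<lambda>i. 0)"
    and ind: "indep n (pairs d) (partials n T v)"
    and G: "sym3 G" "\<And>a b c. \<not> (a < d \<and> b < d \<and> c < d) \<Longrightarrow> G a b c = 0"
  obtains w where "\<And>a. d \<le> a \<Longrightarrow> w a = (\<lambda>i. 0)"
    and "\<And>a b c. tri n T (v a) (v b) (w c) + tri n T (v a) (w b) (v c) + tri n T (w a) (v b) (v c) = G a b c"
proof -
  obtain p where p: "dual_points n (pairs d) (partials n T v) p"
    using ex_dual_points[OF finite_pairs ind] by blast
  define w where "w c i = (\<Sum>s\<in>pairs d. G (fst s) (snd s) c / 3 * p s i)" for c i
  have w_le: "tri n T (v a) (v b) (w c) = G a b c / 3" if "a \<le> b" "b < d" for a b c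
  proof -
    have ab: "(a, b) \<in> pairs d" using that by (simp add: pairs_def)
    have "tri n T (v a) (v b) (w c) = dot n (partials n T v (a, b)) (\<lambda>i. \<Sum>s\<in>pairs d. G (fst s) (snd s) c / 3 * p s i)"
      by (simp add: tri_eq_dot partials_def w_def[abs_def])
    also have "\<dots> = (\<Sum>s\<in>pairs d. G (fst s) (snd s) c / 3 * dot n (partials n T v (a, b)) (p s))"
      by (simp only: dot_sum_right dot_scale_right)
    also have "\<dots> = (\<Sum>s\<in>pairs d. if s = (a, b) then G a b c / 3 else 0)"
      by (rule sum.cong) (use p ab in \<open>auto simp: dual_points_def\<close>)
    finally show ?thesis using ab finite_pairs by simp
  qed
  have w: "tri n T (v a) (v b) (w c) = G a b c / 3" for a b c
  proof (cases "a < d \<and> b < d")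
    case True
    have "tri n T (v a) (v b) (w c) = tri n T (v b) (v a) (w c)" by (rule tri_commute12[OF T])
    moreover have "G a b c = G b a c" using G(1) unfolding sym3_def by blast
    ultimately show ?thesis using w_le[of a b c] w_le[of b a c] True by (cases "a \<le> b") auto
  next
    case False
    then show ?thesis using G(2) by (auto simp: v)
  qed
  show thesis
  proof (rule that)
    show "w a = (\<lambda>i. 0)" if "d \<le> a" for a
      using that by (intro ext) (simp add: w_def G(2))
    fix a b c
    have "tri n T (v a) (w b) (v c) = G a b c / 3" "tri n T (w a) (v b) (v c) = G a b c / 3"
      using w[of a c b] w[of b c a] G(1) tri_commute23[OF T, of n "v a" "w b" "v c"]
        tri_commute12[OF T, of n "w a" "v b" "v c"] tri_commute23[OF T, of n "v b" "w a" "v c"]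
      unfolding sym3_def by metis+
    moreover have "g / 3 + g / 3 + g / 3 = g" for g :: 'a
      using three by (simp add: add_divide_distrib[symmetric])
    ultimately show "tri n T (v a) (v b) (w c) + tri n T (v a) (w b) (v c) + tri n T (w a) (v b) (v c) = G a b c"
      using w[of a b c] by (simp only:)
  qed
qed

text \<open>
  Hensel lifting: since the derivative of the pullback at \<open>v\<close> is surjective, an error \<open>t\<^sup>K R\<close> with
  \<open>K > 0\<close> is removed modulo \<open>t\<^sup>K\<^sup>+\<^sup>1\<close> by adding \<open>t\<^sup>K \<omega>\<close> to the columns, where \<open>\<omega>\<close> solves the linearized equation
  for \<open>- R(0)\<close>.  So the line through \<open>pullback n T v\<close> in the direction \<open>G\<close> is a pullback to any order.
\<close>
lemma hensel_lift_pullback: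
  fixes T :: "nat \<Rightarrow> nat \<Rightarrow> nat \<Rightarrow> 'a::field"
  assumes three: "(3::'a) \<noteq> 0" and T: "sym3 T"
    and v: "\<And>a. d \<le> a \<Longrightarrow> v a = (\<lambda>i. 0)"
    and ind: "indep n (pairs d) (partials n T v)"
    and G: "sym3 G" "\<And>a b c. \<not> (a < d \<and> b < d \<and> c < d) \<Longrightarrow> G a b c = 0"
  shows "\<exists>A. (\<forall>a i. poly (A a i) 0 = v a i) \<and> (\<forall>a\<ge>d. A a = (\<lambda>i. 0)) \<and>
    (\<forall>a b c. [:0, 1:] ^ Suc K dvd
       pullback n (\<lambda>i j k. [:T i j k:]) A a b c - [:pullback n T v a b c, G a b c:])"
proof (induction K)
  case 0
  have "[:0, 1:] ^ Suc 0 dvd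
      pullback n (\<lambda>i j k. [:T i j k:]) (\<lambda>a i. [:v a i:]) a b c - [:pullback n T v a b c, G a b c:]" for a b c
  proof (rule dvdI)
    have "pullback n (\<lambda>i j k. [:T i j k:]) (\<lambda>a i. [:v a i:]) a b c = [:pullback n T v a b c:]"
      unfolding pullback_def by (rule tri_hom[of "\<lambda>c. [:c:]", symmetric]) simp_all
    then show "pullback n (\<lambda>i j k. [:T i j k:]) (\<lambda>a i. [:v a i:]) a b c - [:pullback n T v a b c, G a b c:] =
        [:0, 1:] ^ Suc 0 * [:- G a b c:]" by simp
  qed
  then show ?case
    by (intro exI[of _ "\<lambda>a i. [:v a i:]"] conjI) (simp_all add: v del: power_Suc)
next
  case (Suc K)
  define T' where "T' = (\<lambda>i j k. [:T i j k:])"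
  have T': "sym3 T'" using T unfolding sym3_def T'_def by metis
  define \<tau> :: "'a poly" where "\<tau> = [:0, 1:] ^ Suc K"
  from Suc obtain A where A0: "\<And>a i. poly (A a i) 0 = v a i"
    and Ad: "\<And>a. d \<le> a \<Longrightarrow> A a = (\<lambda>i. 0)"
    and dvd: "\<And>a b c. \<tau> dvd pullback n T' A a b c - [:pullback n T v a b c, G a b c:]"
    unfolding T'_def \<tau>_def by blast
  define R where "R a b c = (pullback n T' A a b c - [:pullback n T v a b c, G a b c:]) div \<tau>" for a b c
  have R: "pullback n T' A a b c - [:pullback n T v a b c, G a b c:] = \<tau> * R a b c" for a b c
    unfolding R_def using dvd by simp
  define H where "H a b c = - poly (R a b c) 0" for a b c
  have "sym3 H"
    using sym3_pullback[OF T', of n A] sym3_pullback[OF T, of n v] G(1)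
    unfolding sym3_def H_def R_def by metis
  moreover have "H a b c = 0" if "\<not> (a < d \<and> b < d \<and> c < d)" for a b c
    using that by (auto simp: H_def R_def pullback_def Ad v G(2))
  ultimately obtain w where wd: "\<And>a. d \<le> a \<Longrightarrow> w a = (\<lambda>i. 0)"
    and w: "\<And>a b c. tri n T (v a) (v b) (w c) + tri n T (v a) (w b) (v c) + tri n T (w a) (v b) (v c) = H a b c"
    using linearized_pullback_solvable[OF three T v ind] by metis
  define \<omega> where "\<omega> a i = [:w a i:]" for a i
  define A' where "A' a i = A a i + \<tau> * \<omega> a i" for a i
  have "[:0, 1:] ^ Suc (Suc K) dvd pullback n T' A' a b c - [:pullback n T v a b c, G a b c:]" for a b c
  proof -
    define E where "E = R a b c + (tri n T' (A a) (A b) (\<omega> c) + tri n T' (A a) (\<omega> b) (A c) + tri n T' (\<omega> a) (A b) (A c))"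
    define F where "F = tri n T' (A a) (\<omega> b) (\<omega> c) + tri n T' (\<omega> a) (A b) (\<omega> c) + tri n T' (\<omega> a) (\<omega> b) (A c)
        + \<tau> * tri n T' (\<omega> a) (\<omega> b) (\<omega> c)"
    have "pullback n T' A' a b c = pullback n T' A a b c + \<tau> *
        (tri n T' (A a) (A b) (\<omega> c) + tri n T' (A a) (\<omega> b) (A c) + tri n T' (\<omega> a) (A b) (A c)) + \<tau> * \<tau> * F"
      unfolding pullback_def A'_def[abs_def] tri_add tri_scale F_def by (simp add: algebra_simps)
    then have "pullback n T' A' a b c - [:pullback n T v a b c, G a b c:] = \<tau> * E + \<tau> * \<tau> * F"
      using R[of a b c] unfolding E_def by (simp add: algebra_simps)
    moreover have "poly E 0 = 0"
    proof -
      have *: "poly (tri n T' x y z) 0 = tri n T (\<lambda>i. poly (x i) 0) (\<lambda>i. poly (y i) 0) (\<lambda>i. poly (z i) 0)" for x y z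
        by (subst tri_hom[of "\<lambda>p. poly p 0"]) (simp_all add: T'_def)
      show ?thesis using w[of a b c] by (simp add: E_def * A0 \<omega>_def H_def)
    qed
    then have "[:0, 1:] dvd E" using poly_eq_0_iff_dvd[of E 0] by simp
    then have "\<tau> * [:0, 1:] dvd \<tau> * E" by (rule mult_dvd_mono[OF dvd_refl])
    moreover have "\<tau> * [:0, 1:] dvd \<tau> * \<tau> * F"
    proof -
      have "[:0, 1:] dvd \<tau>" by (simp only: \<tau>_def power_Suc dvd_triv_left)
      then show ?thesis by (intro dvd_mult2 mult_dvd_mono dvd_refl)
    qed
    ultimately show ?thesis
      unfolding \<tau>_def power_Suc2[of _ "Suc K"] by (metis dvd_add)
  qed
  moreover have "poly (A' a i) 0 = v a i" for a i by (simp add: A'_def A0 \<tau>_def)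
  moreover have "A' a = (\<lambda>i. 0)" if "d \<le> a" for a
    using that by (intro ext) (simp add: A'_def Ad \<omega>_def wd)
  ultimately show ?case unfolding T'_def by blast
qed

text \<open>
  Let \<open>Y\<close> be the line from the pullback along \<open>v\<close>, at \<open>t = 0\<close>, to \<open>U\<close>, at \<open>t = 1\<close>.  The equation \<open>\<phi>\<close> vanishes on
  pullbacks, and \<open>Y\<close> agrees with a pullback modulo any power of \<open>t\<close>.  Hence the polynomial \<open>\<phi>(Y(t))\<close> is
  divisible by a power of \<open>t\<close> above its degree; it is 0, and so is its value at \<open>t = 1\<close>.
\<close>
lemma vanishing_on_orbit_imp_everywhere:
  fixes T :: "nat \<Rightarrow> nat \<Rightarrow> nat \<Rightarrow> 'a::alg_closed_field"
  assumes three: "(3::'a) \<noteq> 0" and T: "sym3 T"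
    and ind: "indep n (pairs d) (partials n T v)"
    and \<phi>: "\<And>g. g \<in> carrier_mat n n \<Longrightarrow> invertible_mat g \<Longrightarrow>
      mpoly_eval id (Poly_Mapping.lookup (mat_subst n g (cub n T))) \<phi> = 0"
    and U: "sym3 U" "\<And>a b c. \<not> (a < d \<and> b < d \<and> c < d) \<Longrightarrow> U a b c = 0"
  shows "mpoly_eval id (Poly_Mapping.lookup (cub n U)) \<phi> = 0"
proof -
  (* With the columns beyond d set to zero, the pullback is a cubic in d variables. *)
  define v' where "v' a = (if a < d then v a else (\<lambda>i. 0))" for a
  have "indep n (pairs d) (partials n T v')"
  proof -
    have "partials n T v' s = partials n T v s" if "s \<in> pairs d" for s
      using that by (auto simp: partials_def pairs_def v'_def)
    then show ?thesis using ind unfolding indep_def by (simp cong: sum.cong)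
  qed
  define G where "G a b c = U a b c - pullback n T v' a b c" for a b c
  define Y where "Y a b c = [:pullback n T v' a b c, G a b c:]" for a b c
  (* Y does not depend on the precision of the lift, so its degree may determine that precision. *)
  define K where "K = degree (eval_family n \<phi> Y)"
  have "sym3 G" using U(1) sym3_pullback[OF T, of n v'] unfolding sym3_def G_def by metis
  moreover have "G a b c = 0" if "\<not> (a < d \<and> b < d \<and> c < d)" for a b c
    using that by (auto simp: G_def U(2) pullback_def v'_def)
  moreover have "v' a = (\<lambda>i. 0)" if "d \<le> a" for a using that by (simp add: v'_def)
  ultimately obtain A where A: "\<And>a b c. [:0, 1:] ^ Suc K dvd pullback n (\<lambda>i j k. [:T i j k:]) A a b c - Y a b c"
    using hensel_lift_pullback[OF three T _ \<open>indep n (pairs d) (partials n T v')\<close>, of G K]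
    unfolding Y_def by blast
  let ?X = "pullback n (\<lambda>i j k. [:T i j k:]) A"
  have "poly (eval_family n \<phi> ?X) t = 0" for t
  proof -
    have "(\<lambda>a b c. poly (?X a b c) t) = pullback n T (\<lambda>a i. poly (A a i) t)"
      unfolding pullback_def by (intro ext, subst tri_hom[of "\<lambda>p. poly p t"]) simp_all
    then show ?thesis
      using vanishing_on_orbit_imp_on_pullbacks[OF \<phi>] by (simp add: poly_eval_family)
  qed
  then have "eval_family n \<phi> ?X = 0"
    by (intro poly_eq_0_if_cofinitely_many_roots) simp
  then have "[:0, 1:] ^ Suc K dvd eval_family n \<phi> Y"
    using eval_family_cong[where M = "[:0, 1:] ^ Suc K" and T = ?X and U = Y and \<phi> = \<phi> and n = n] A by simp
  moreover have "degree ([:0, 1 :: 'a:] ^ Suc K) = Suc K"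
    by (subst degree_power_eq) simp_all
  ultimately have "eval_family n \<phi> Y = 0"
    using dvd_imp_degree_le[of "[:0, 1:] ^ Suc K" "eval_family n \<phi> Y"] by (auto simp: K_def)
  then have "poly (eval_family n \<phi> Y) 1 = 0" by simp
  then show ?thesis by (simp add: poly_eval_family Y_def G_def)
qed

section \<open>The orbit closure\<close>

text \<open>
  A cubic in the first \<open>d\<close> variables is its own restriction, so it suffices that every such cubic lies
  in the orbit closure, that is, satisfies every equation of the orbit.  Some \<open>v\<close> has
  independent forms \<open>T(v\<^sub>i, v\<^sub>j, _)\<close>, because otherwise the isotropic subspace found above would bound
  the q-rank by \<open>2 d\<^sup>2\<close>.
\<close>
theorem orbit_closure_surjects_if_q_rank_large:
  fixes f :: "(nat, 'a::alg_closed_field) mpoly"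
  assumes char: "CHAR('a) \<noteq> 2" "CHAR('a) \<noteq> 3"
    and f: "f \<in> homog 3 n" and r: "q_rank n f > 2 * (d * d)"
  shows "restrict_vars d ` orbit_closure n f = homog 3 d"
proof -
  note nz = three_six_nonzero[OF char]
  obtain T where T: "sym3 T" and fT: "f = cub n T"
    using homog_3_eq_cub[OF nz(2) f] by blast
  have "q_rank n f \<le> n" unfolding fT by (rule q_rank_cub_le_dim[OF nz(2) T])
  then have "d \<le> n" using r by (metis le_square le_trans less_imp_le mult_2 trans_le_add1)
  obtain v where v: "indep n (pairs d) (partials n T v)"
  proof (rule ccontr)
    assume "\<not> thesis"
    then have "\<And>v. \<not> indep n (pairs d) (partials n T v)" using that by blast
    from isotropic_subspace_if_partials_dependent[OF T this] obtain S
      where "finite S" "card S \<le> 2 * (d * d)" "\<And>w. (\<And>s. s \<in> S \<Longrightarrow> dot n s w = 0) \<Longrightarrow> tri n T w w w = 0"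
      by metis
    then show False using q_rank_cub_le_card[OF nz(2) T, of S n] r fT by fastforce
  qed
  have orbit: "GL_orbit n f \<subseteq> homog 3 n"
    by (auto simp: GL_orbit_def fT mat_subst_cub cub_in_homog)
  show ?thesis
  proof
    have "orbit_closure n f \<subseteq> homog 3 n"
      unfolding orbit_closure_def using closure_of_subset_topspace[of "zariski 3 n"] by simp
    moreover have "restrict_vars d h \<in> homog 3 d" if "h \<in> homog 3 n" for h :: "(nat, 'a) mpoly"
      using homog_3_eq_cub[OF nz(2) that order_refl] restrict_vars_in_homog by metis
    ultimately show "restrict_vars d ` orbit_closure n f \<subseteq> homog 3 d" by blast
  next
    show "homog 3 d \<subseteq> restrict_vars d ` orbit_closure n f"
    proof
      fix g :: "(nat, 'a) mpoly" assume "g \<in> homog 3 d"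
      then obtain U where U: "sym3 U" "\<And>i j k. \<not> (i < d \<and> j < d \<and> k < d) \<Longrightarrow> U i j k = 0"
        and g: "g = cub n U"
        using homog_3_eq_cub[OF nz(2) _ \<open>d \<le> n\<close>] by metis
      have "closedin (zariski 3 n) (orbit_closure n f)"
        unfolding orbit_closure_def by (rule closedin_closure_of)
      then obtain \<Phi> where \<Phi>: "orbit_closure n f = zero_locus 3 n \<Phi>"
        unfolding closedin_zariski by blast
      have sub: "GL_orbit n f \<subseteq> zero_locus 3 n \<Phi>"
        unfolding \<Phi>[symmetric] orbit_closure_def by (rule closure_of_subset) (simp add: orbit)
      have "mpoly_eval id (Poly_Mapping.lookup g) \<phi> = 0" if "\<phi> \<in> \<Phi>" for \<phi>
        unfolding g
      proof (rule vanishing_on_orbit_imp_everywhere[OF nz(1) T v _ U])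
        fix h :: "'a mat" assume "h \<in> carrier_mat n n" "invertible_mat h"
        then have "mat_subst n h (cub n T) \<in> GL_orbit n f" unfolding GL_orbit_def fT by blast
        then show "mpoly_eval id (Poly_Mapping.lookup (mat_subst n h (cub n T))) \<phi> = 0"
          using sub that by (auto simp: zero_locus_def)
      qed
      then have "g \<in> orbit_closure n f"
        unfolding \<Phi> zero_locus_def using cub_in_homog by (auto simp: g)
      moreover have "restrict_vars d g = g" unfolding g by (rule restrict_vars_id[OF U(2)])
      ultimately show "g \<in> restrict_vars d ` orbit_closure n f" by force
    qed
  qed
qed

theorem theorem1p8:
  fixes f :: "(nat, 'a::alg_closed_field) mpoly" and n d r :: nat
  assumes "CHAR('a) \<noteq> 2" and "CHAR('a) \<noteq> 3"
    and "n > 0"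
    and "f \<in> homog 3 n"
    and "r = q_rank n f" and "real r > exp 240"
    and "d > 0" and "real d \<le> 1 / 3 * ln (real r)"
  shows "restrict_vars d ` orbit_closure n f = homog 3 d"
proof -
  have r0: "real r > 0" using assms(6) exp_gt_zero[of "240::real"] by linarith
  have "(3 * real d)\<^sup>2 = 9 * (real d * real d)" by (simp add: power2_eq_square)
  then have "2 * (real d * real d) < 1 + 3 * real d + (3 * real d)\<^sup>2 / 2"
    using zero_le_square[of "real d"] by linarith
  also have "\<dots> \<le> exp (3 * real d)" by (rule exp_lower_Taylor_quadratic) simp
  also have "\<dots> \<le> exp (ln (real r))" using assms(8) by simp
  also have "\<dots> = real r" using r0 by simp
  finally have "real (2 * (d * d)) < real r" by simp
  then have "2 * (d * d) < q_rank n f" unfolding assms(5) of_nat_less_iff .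
  then show ?thesis by (rule orbit_closure_surjects_if_q_rank_large[OF assms(1,2,4)])
qed

end
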